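(* Let $A\in\mathbb{C}^{n\times n}$ ($n\ge 1$) be factorized as $A=Q\,\mathrm{diag}(J_1,\ldots,J_p)\,Q^{-1}$, where $Q\in\mathbb{C}^{n\times n}$ is nonsingular and each $J_i\in\mathbb{C}^{m_i\times m_i}$ ($\sum_{i=1}^p m_i=n$) is a Jordan block. Let $\widetilde{A}=A+E$ with $E\in\mathbb{C}^{n\times n}$ arbitrary. Let $\{\lambda_i\}_{i=1}^n$ and $\{\widetilde{\lambda}_i\}_{i=1}^n$ be the spectra of $A$ and $\widetilde{A}$, respectively. Put $m=\max_{1\le i\le p}m_i$ and $E_Q=Q^{-1}EQ$. Then there exists a permutation $\pi$ of $\{1,\ldots,n\}$ such that $$\Big(\sum_{i=1}^n|\widetilde{\lambda}_{\pi(i)}-\lambda_i|^2\Big)^{1/2}\le\begin{cases}\sqrt{n\big(n-p+2\sqrt{n-p}\,\delta(E_Q)+1\big)\delta(E_Q)^{2/m}+\frac1n|\mathrm{tr}(E)|^2}, & \text{if } \delta(E_Q)<1,\\[2mm] \sqrt{n\big(\sqrt{n-p}+\delta(E_Q)\big)^2+\frac1n|\mathrm{tr}(E)|^2}, & \text{if } \delta(E_Q)\ge 1.\end{cases}$$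
   Context: $\|\cdot\|_F$ is the Frobenius norm and $\mathrm{tr}$ the trace. For $Y\in\mathbb{C}^{n\times n}$, $\delta(Y):=\big(\|Y\|_F^2-\frac1n|\mathrm{tr}(Y)|^2\big)^{1/2}$. Spectra are listed with algebraic multiplicity (so each has exactly $n$ entries). A Jordan block of size $m_i$ is an upper bidiagonal $m_i\times m_i$ matrix with a constant complex number on the diagonal, ones on the first superdiagonal, and zeros elsewhere; blocks may share the same eigenvalue. *)

theory Defs
  imports Complex_Main "Jordan_Normal_Form.Jordan_Normal_Form"
begin

definition mat_trace :: "complex mat \<Rightarrow> complex" where
  "mat_trace Y = (\<Sum>i<dim_row Y. Y $$ (i, i))"

definition frobenius_norm :: "complex mat \<Rightarrow> real" where
  "frobenius_norm Y = sqrt (\<Sum>i<dim_row Y. \<Sum>j<dim_col Y. (cmod (Y $$ (i, j)))\<^sup>2)"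

(* For square Y of positive size n = dim_row Y. The radicand is then nonnegative by
   Cauchy-Schwarz, so sqrt is the usual square root of a nonnegative real. *)
definition delta :: "complex mat \<Rightarrow> real" where
  "delta Y = sqrt ((frobenius_norm Y)\<^sup>2 - 1 / real (dim_row Y) * (cmod (mat_trace Y))\<^sup>2)"

(* l 1, ..., l n is a listing of the spectrum of A: every z occurs exactly as often as its
   algebraic multiplicity, the order of z as a root of the characteristic polynomial
   (which is 0 when z is not an eigenvalue). *)
definition spectrum_listing :: "nat \<Rightarrow> complex mat \<Rightarrow> (nat \<Rightarrow> complex) \<Rightarrow> bool" where
  "spectrum_listing n A l \<longleftrightarrow>
     (\<forall>z. card {i \<in> {1..n}. l i = z} = order z (char_poly A))"

end

theory Submission
  imports Defs "HOL-Combinatorics.Permutations" "HOL-Analysis.L2_Norm"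
    "Jordan_Normal_Form.Schur_Decomposition"
begin

text \<open>
The bound follows from an eigenvalue variation theorem for normal matrices by a suitable scaling.

If \<open>D\<close> is diagonal and \<open>M\<close> arbitrary, some matching of the eigenvalues has squared
error at most \<open>n\<close> times the squared Frobenius norm of \<open>M - D\<close> (\<open>eigenvalue_variation_diag\<close>). In a
unitary Schur basis of \<open>M\<close> (\<open>unitary_schur\<close>) one compares a triangular \<open>T\<close> with a normal \<open>N\<close>. A normal
matrix has equal row and column norms, and this forces the squared norm of its strictly upper part to be at
most \<open>n - 1\<close> times that of its strictly lower part (\<open>upper_sum_le_lower_sum\<close>). The lower part of \<open>N\<close> is seen by
\<open>T - N\<close>, so \<open>T\<close> can be replaced by its diagonal at the price of the factor \<open>n\<close>
(\<open>normal_minus_diag_of_upper_triangular\<close>). Two normal matrices are then compared by the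
Hoffman-Wielandt theorem (\<open>hoffman_wielandt_diag\<close>), which rests on the fact that doubly stochastic
averages of assignment costs are never below the best assignment (\<open>doubly_stochastic_assignment\<close>);
that in turn comes from Hall's marriage theorem.

Conjugation by \<open>Q\<close> turns the problem into a perturbation of a Jordan matrix by \<open>EQ\<close>.
Conjugating further by a diagonal matrix of powers of \<open>\<epsilon>\<close> in \<open>(0, 1]\<close> makes the superdiagonal ones into \<open>\<epsilon>\<close>,
so that the Jordan matrix becomes nearly diagonal, while entries of the perturbation grow at most by
the factor \<open>1 / \<epsilon> ^ (m - 1)\<close>. Expanding the square of the norm keeps the mixed term small
(\<open>scaled_perturbation_bound\<close>). The trace of the perturbation merely translates the spectrum, and is split
off orthogonally; the remaining trace-free part has norm \<open>delta EQ\<close> (\<open>delta_eq_frobenius_norm\<close>).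

The two cases of the bound are the choices \<open>\<epsilon> = delta EQ powr (1 / m)\<close> and \<open>\<epsilon> = 1\<close>. When \<open>delta EQ = 0\<close>
the first choice degenerates, and \<open>\<epsilon>\<close> tends to \<open>0\<close> instead.
\<close>

section \<open>Optimal assignments and doubly stochastic weights\<close>

text \<open>Rado's argument: as long as some \<open>S i\<close> has two elements \<open>x\<close> and \<open>y\<close>, one of them can be deleted
without violating Hall's condition, so induction on the total size reduces to singletons. If
neither could be deleted, there would be sets \<open>J\<close> and \<open>K\<close> of other indices that become too crowded once
\<open>x\<close>, respectively \<open>y\<close>, is removed from \<open>S i\<close>. Counting the union and the intersection of the two
neighbourhoods, and applying Hall's condition to \<open>J \<union> K \<union> {i}\<close> and \<open>J \<inter> K\<close>, gives a contradiction.\<close>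
lemma hall_marriage:
  fixes S :: "'a \<Rightarrow> 'b set"
  assumes "finite I" and "\<And>i. i \<in> I \<Longrightarrow> finite (S i)"
    and "\<And>J. J \<subseteq> I \<Longrightarrow> card J \<le> card (\<Union>i\<in>J. S i)"
  shows "\<exists>f. inj_on f I \<and> (\<forall>i\<in>I. f i \<in> S i)"
  using assms
proof (induction "\<Sum>i\<in>I. card (S i)" arbitrary: S rule: less_induct)
  case less
  note fin = \<open>finite I\<close> less.prems(2) and hall = less.prems(3)
  have finU: "finite (\<Union>i\<in>J. S i)" if "J \<subseteq> I" for J
    using that fin by (intro finite_UN_I) (auto intro: finite_subset)
  show ?case
  proof (cases "\<exists>i\<in>I. \<exists>x\<in>S i. \<exists>y\<in>S i. x \<noteq> y")
    case False
    have ne: "S i \<noteq> {}" if "i \<in> I" for i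
      using hall[of "{i}"] that by auto
    define f where "f i = (SOME x. x \<in> S i)" for i
    have f: "f i \<in> S i" if "i \<in> I" for i
      unfolding f_def using ne[OF that] by (simp add: some_in_eq)
    have "S i = {f i}" if "i \<in> I" for i
      using f[OF that] False that by blast
    moreover have "i = j" if "i \<in> I" "j \<in> I" "f i = f j" for i j
    proof (rule ccontr)
      assume "i \<noteq> j"
      moreover have "(\<Union>k\<in>{i,j}. S k) = {f i}"
        using that \<open>\<And>i. i \<in> I \<Longrightarrow> S i = {f i}\<close> by simp
      ultimately show False
        using hall[of "{i,j}"] that by simp
    qed
    ultimately show ?thesis
      using f by (intro exI[of _ f]) (simp add: inj_on_def)
  next
    case True
    then obtain i x y where i: "i \<in> I" and xy: "x \<in> S i" "y \<in> S i" "x \<noteq> y"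
      by blast
    have shrink: "\<exists>J\<subseteq>I - {i}. card ((\<Union>j\<in>J. S j) \<union> (S i - {z})) \<le> card J"
      if z: "z \<in> S i" and no: "\<not> (\<exists>f. inj_on f I \<and> (\<forall>i\<in>I. f i \<in> S i))" for z
    proof -
      let ?S = "S(i := S i - {z})"
      have "(\<Sum>j\<in>I. card (?S j)) < (\<Sum>j\<in>I. card (S j))"
        using fin i card_Diff1_less[OF fin(2)[OF i] z]
        by (intro sum_strict_mono_ex1) (auto intro: card_Diff1_le)
      moreover have "\<not> (\<exists>f. inj_on f I \<and> (\<forall>i\<in>I. f i \<in> ?S i))"
        using no by (metis DiffD1 fun_upd_apply)
      moreover have "finite (?S j)" if "j \<in> I" for j
        using fin(2)[OF that] by (cases "j = i") auto
      ultimately have "\<not> (\<forall>J\<subseteq>I. card J \<le> card (\<Union>j\<in>J. ?S j))"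
        using less.hyps[of ?S] fin(1) by blast
      then obtain J where J: "J \<subseteq> I" "card (\<Union>j\<in>J. ?S j) < card J"
        by (auto simp: not_le)
      have iJ: "i \<in> J"
      proof (rule ccontr)
        assume "i \<notin> J"
        then have "(\<Union>j\<in>J. ?S j) = (\<Union>j\<in>J. S j)" by auto
        with J hall[of J] show False by simp
      qed
      have "(\<Union>j\<in>J. ?S j) = (\<Union>j\<in>J - {i}. S j) \<union> (S i - {z})"
        using iJ by (auto split: if_splits)
      moreover have "card J = Suc (card (J - {i}))"
        using iJ J(1) fin(1) by (metis card.remove finite_subset)
      ultimately show ?thesis
        using J by (intro exI[of _ "J - {i}"]) auto
    qed
    show ?thesis
    proof (rule ccontr)
      assume no: "\<not> ?thesis"
      obtain J where J: "J \<subseteq> I - {i}" "card ((\<Union>j\<in>J. S j) \<union> (S i - {x})) \<le> card J"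
        using shrink[OF xy(1) no] by blast
      obtain K where K: "K \<subseteq> I - {i}" "card ((\<Union>j\<in>K. S j) \<union> (S i - {y})) \<le> card K"
        using shrink[OF xy(2) no] by blast
      let ?X = "(\<Union>j\<in>J. S j) \<union> (S i - {x})" and ?Y = "(\<Union>j\<in>K. S j) \<union> (S i - {y})"
      have fJK: "finite J" "finite K" using J K fin(1) by (meson finite_Diff finite_subset)+
      have fXY: "finite ?X" "finite ?Y"
        using finU[of J] finU[of K] J K fin(2)[OF i] by auto
      have un: "?X \<union> ?Y = (\<Union>j\<in>insert i (J \<union> K). S j)" using xy by auto
      have "Suc (card (J \<union> K)) = card (insert i (J \<union> K))"
        using J K fJK by (subst card_insert_disjoint) auto
      also have "\<dots> \<le> card (?X \<union> ?Y)"
        unfolding un using J K i by (intro hall) auto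
      finally have a: "Suc (card (J \<union> K)) \<le> card (?X \<union> ?Y)" .
      have "card (J \<inter> K) \<le> card (\<Union>j\<in>J \<inter> K. S j)"
        using J by (intro hall) auto
      also have "\<dots> \<le> card (?X \<inter> ?Y)"
        using fXY by (intro card_mono) auto
      finally have b: "card (J \<inter> K) \<le> card (?X \<inter> ?Y)" .
      have "card ?X + card ?Y = card (?X \<union> ?Y) + card (?X \<inter> ?Y)"
        using fXY by (rule card_Un_Int)
      moreover have "card J + card K = card (J \<union> K) + card (J \<inter> K)"
        using fJK by (rule card_Un_Int)
      ultimately show False using a b J(2) K(2) by linarith
    qed
  qed
qed

text \<open>The bipartite graph of the positive entries satisfies Hall's condition: the rows in \<open>J\<close> carry total mass
\<open>card J * s\<close>, all of it in the columns adjacent to \<open>J\<close>, and each column carries mass only \<open>s\<close>.\<close>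
lemma positive_permutation_if_line_sums_equal:
  fixes W :: "'a \<Rightarrow> 'a \<Rightarrow> real"
  assumes A: "finite A" and nonneg: "\<And>i j. i \<in> A \<Longrightarrow> j \<in> A \<Longrightarrow> 0 \<le> W i j"
    and rows: "\<And>i. i \<in> A \<Longrightarrow> (\<Sum>j\<in>A. W i j) = s"
    and cols: "\<And>j. j \<in> A \<Longrightarrow> (\<Sum>i\<in>A. W i j) = s"
    and s: "0 < s"
  shows "\<exists>\<pi>. \<pi> permutes A \<and> (\<forall>i\<in>A. 0 < W i (\<pi> i))"
proof -
  define S where "S i = {j \<in> A. 0 < W i j}" for i
  have "\<exists>f. inj_on f A \<and> (\<forall>i\<in>A. f i \<in> S i)"
  proof (rule hall_marriage)
    fix J assume J: "J \<subseteq> A"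
    let ?N = "\<Union>i\<in>J. S i"
    have N: "?N \<subseteq> A" by (auto simp: S_def)
    have "real (card J) * s = (\<Sum>i\<in>J. \<Sum>j\<in>A. W i j)"
      using J rows by (simp add: subset_iff)
    also have "\<dots> = (\<Sum>i\<in>J. \<Sum>j\<in>?N. W i j)"
    proof (rule sum.cong[OF refl])
      fix i assume i: "i \<in> J"
      show "(\<Sum>j\<in>A. W i j) = (\<Sum>j\<in>?N. W i j)"
      proof (rule sum.mono_neutral_right[OF A N], rule ballI)
        fix j assume j: "j \<in> A - ?N"
        then have "\<not> 0 < W i j" using i by (auto simp: S_def)
        moreover have "0 \<le> W i j" using nonneg i j J by blast
        ultimately show "W i j = 0" by simp
      qed
    qed
    also have "\<dots> \<le> (\<Sum>i\<in>A. \<Sum>j\<in>?N. W i j)"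
      using A J N nonneg by (intro sum_mono2) (auto intro!: sum_nonneg)
    also have "\<dots> = (\<Sum>j\<in>?N. \<Sum>i\<in>A. W i j)" by (rule sum.swap)
    also have "\<dots> = real (card ?N) * s"
      using N cols by (simp add: subset_iff)
    finally show "card J \<le> card ?N" using s by simp
  qed (use A in \<open>auto simp: S_def\<close>)
  then obtain f where f: "inj_on f A" "\<forall>i\<in>A. f i \<in> S i" by blast
  define \<pi> where "\<pi> i = (if i \<in> A then f i else i)" for i
  have "f ` A = A"
    using f A by (intro card_subset_eq) (auto simp: S_def card_image)
  then have "bij_betw \<pi> A A"
    using f(1) by (auto simp: bij_betw_def \<pi>_def inj_on_def image_iff)
  then have "\<pi> permutes A"
    by (rule bij_imp_permutes) (simp add: \<pi>_def)
  then show ?thesis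
    using f(2) by (intro exI[of _ \<pi>]) (auto simp: \<pi>_def S_def)
qed

text \<open>The optimisation content of Birkhoff's theorem. Subtracting the largest possible multiple of a positive
permutation from \<open>W\<close> kills an entry and keeps all line sums equal; the subtracted part contributes at
least its mass times the smallest permutation cost. Letting the common line sum \<open>s\<close> be arbitrary
makes the induction on the number of nonzero entries go through.\<close>
lemma permutation_cost_le:
  fixes W c :: "'a \<Rightarrow> 'a \<Rightarrow> real"
  assumes A: "finite A"
    and "\<And>i j. i \<in> A \<Longrightarrow> j \<in> A \<Longrightarrow> 0 \<le> W i j"
    and "\<And>i. i \<in> A \<Longrightarrow> (\<Sum>j\<in>A. W i j) = s"
    and "\<And>j. j \<in> A \<Longrightarrow> (\<Sum>i\<in>A. W i j) = s"
    and M: "\<And>\<pi>. \<pi> permutes A \<Longrightarrow> M \<le> (\<Sum>i\<in>A. c i (\<pi> i))"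
    and "0 \<le> s"
  shows "s * M \<le> (\<Sum>i\<in>A. \<Sum>j\<in>A. c i j * W i j)"
  using assms(2-4,6)
proof (induction "card {p \<in> A \<times> A. W (fst p) (snd p) \<noteq> 0}" arbitrary: W s rule: less_induct)
  case less
  note nonneg = less.prems(1) and rows = less.prems(2) and cols = less.prems(3)
  show ?case
  proof (cases "s = 0 \<or> A = {}")
    case True
    have "W i j = 0" if "s = 0" "i \<in> A" "j \<in> A" for i j
      using that rows[of i] nonneg A sum_nonneg_eq_0_iff[of A "W i"] by simp
    moreover have "M \<le> 0" if "A = {}"
      using M[OF permutes_id] that by simp
    ultimately show ?thesis
      using True less.prems(4) by (auto simp: mult_le_0_iff)
  next
    case False
    then have s: "0 < s" and ne: "A \<noteq> {}" using less.prems(4) by auto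
    obtain \<pi> where \<pi>: "\<pi> permutes A" "\<forall>i\<in>A. 0 < W i (\<pi> i)"
      using positive_permutation_if_line_sums_equal[OF A nonneg rows cols s] by blast
    define t where "t = Min ((\<lambda>i. W i (\<pi> i)) ` A)"
    have t_le: "t \<le> W i (\<pi> i)" if "i \<in> A" for i
      unfolding t_def using A that by simp
    obtain k where k: "k \<in> A" "t = W k (\<pi> k)"
      using Min_in[of "(\<lambda>i. W i (\<pi> i)) ` A"] A ne unfolding t_def by (metis finite_imageI image_iff image_is_empty)
    have t: "0 < t" using k \<pi> by simp
    have \<pi>A: "\<pi> i \<in> A" if "i \<in> A" for i
      using that \<pi>(1) by (simp add: permutes_in_image)
    define V where "V i j = W i j - (if j = \<pi> i then t else 0)" for i j
    have rowV: "(\<Sum>j\<in>A. V i j) = s - t" if "i \<in> A" for i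
      using that rows A \<pi>A by (simp add: V_def sum_subtractf)
    have colV: "(\<Sum>i\<in>A. V i j) = s - t" if j: "j \<in> A" for j
    proof -
      have "(j = \<pi> i) = (i = inv_into UNIV \<pi> j)" for i
        using \<pi>(1) by (metis permutes_inverses)
      then show ?thesis
        using j cols A \<pi>(1) permutes_in_image[OF permutes_inv[OF \<pi>(1)], of j]
        by (simp add: V_def sum_subtractf)
    qed
    have Vnn: "0 \<le> V i j" if "i \<in> A" "j \<in> A" for i j
      using that nonneg t_le by (simp add: V_def)
    then have "0 \<le> (\<Sum>j\<in>A. V k j)"
      using k by (intro sum_nonneg) auto
    then have st: "0 \<le> s - t" using rowV k by simp
    have "card {p \<in> A \<times> A. V (fst p) (snd p) \<noteq> 0} < card {p \<in> A \<times> A. W (fst p) (snd p) \<noteq> 0}"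
    proof (rule psubset_card_mono)
      have "(k, \<pi> k) \<in> {p \<in> A \<times> A. W (fst p) (snd p) \<noteq> 0} - {p \<in> A \<times> A. V (fst p) (snd p) \<noteq> 0}"
        using k t \<pi>A by (auto simp: V_def)
      moreover have "W i j \<noteq> 0" if "V i j \<noteq> 0" "i \<in> A" for i j
        using that \<pi>(2) by (auto simp: V_def split: if_splits)
      then have "{p \<in> A \<times> A. V (fst p) (snd p) \<noteq> 0} \<subseteq> {p \<in> A \<times> A. W (fst p) (snd p) \<noteq> 0}"
        by auto
      ultimately show "{p \<in> A \<times> A. V (fst p) (snd p) \<noteq> 0} \<subset> {p \<in> A \<times> A. W (fst p) (snd p) \<noteq> 0}"
        by blast
    qed (use A in auto)
    then have IH: "(s - t) * M \<le> (\<Sum>i\<in>A. \<Sum>j\<in>A. c i j * V i j)"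
      using less.hyps[of V "s - t"] Vnn rowV colV st by blast
    have "c i j * W i j = c i j * V i j + (if j = \<pi> i then t * c i j else 0)" for i j
      by (simp add: V_def algebra_simps)
    then have "(\<Sum>i\<in>A. \<Sum>j\<in>A. c i j * W i j)
        = (\<Sum>i\<in>A. \<Sum>j\<in>A. c i j * V i j) + t * (\<Sum>i\<in>A. c i (\<pi> i))"
      using A \<pi>A by (simp add: sum.distrib sum_distrib_left)
    moreover have "t * M \<le> t * (\<Sum>i\<in>A. c i (\<pi> i))"
      using t M[OF \<pi>(1)] by simp
    ultimately show ?thesis using IH by (simp add: algebra_simps)
  qed
qed

lemma doubly_stochastic_assignment:
  fixes W c :: "'a \<Rightarrow> 'a \<Rightarrow> real"
  assumes A: "finite A"
    and "\<And>i j. i \<in> A \<Longrightarrow> j \<in> A \<Longrightarrow> 0 \<le> W i j"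
    and "\<And>i. i \<in> A \<Longrightarrow> (\<Sum>j\<in>A. W i j) = 1"
    and "\<And>j. j \<in> A \<Longrightarrow> (\<Sum>i\<in>A. W i j) = 1"
  shows "\<exists>\<pi>. \<pi> permutes A \<and> (\<Sum>i\<in>A. c i (\<pi> i)) \<le> (\<Sum>i\<in>A. \<Sum>j\<in>A. c i j * W i j)"
proof -
  let ?cost = "\<lambda>\<pi>. \<Sum>i\<in>A. c i (\<pi> i)"
  let ?C = "?cost ` {\<pi>. \<pi> permutes A}"
  have fin: "finite ?C" using finite_permutations[OF A] by simp
  have "id permutes A" by (rule permutes_id)
  then have "?C \<noteq> {}" by blast
  then obtain \<pi> where \<pi>: "\<pi> permutes A" "?cost \<pi> = Min ?C"
    using Min_in[OF fin] by auto
  have "1 * Min ?C \<le> (\<Sum>i\<in>A. \<Sum>j\<in>A. c i j * W i j)"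
    using assms fin by (intro permutation_cost_le) auto
  with \<pi> show ?thesis by auto
qed

section \<open>Balanced nonnegative matrices\<close>

lemma sum_sum_if_eq:
  "(\<Sum>i<n. \<Sum>j<n. if i = j then f i j else 0) = (\<Sum>i<(n::nat). (f i i :: 'a :: comm_monoid_add))"
  by (intro sum.cong) auto

text \<open>Weighting the balance equation of line \<open>i\<close> by \<open>i\<close> and summing gives \<open>\<Sum>i j. (i - j) * a i j = 0\<close>. Entries
above the diagonal enter with weight at most \<open>-1\<close> and entries below it with weight at most \<open>n - 1\<close>.\<close>
lemma upper_sum_le_lower_sum:
  fixes a :: "nat \<Rightarrow> nat \<Rightarrow> real"
  assumes nonneg: "\<And>i j. 0 \<le> a i j"
    and balanced: "\<And>i. i < n \<Longrightarrow> (\<Sum>j<n. a i j) = (\<Sum>j<n. a j i)"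
  shows "(\<Sum>i<n. \<Sum>j<n. if i < j then a i j else 0)
    \<le> (real n - 1) * (\<Sum>i<n. \<Sum>j<n. if j < i then a i j else 0)"
proof -
  have "(\<Sum>i<n. \<Sum>j<n. (real i - real j) * a i j)
      = (\<Sum>i<n. real i * (\<Sum>j<n. a i j)) - (\<Sum>i<n. \<Sum>j<n. real j * a i j)"
    by (simp add: left_diff_distrib sum_subtractf sum_distrib_left)
  also have "(\<Sum>i<n. \<Sum>j<n. real j * a i j) = (\<Sum>j<n. real j * (\<Sum>i<n. a i j))"
    by (subst sum.swap) (simp add: sum_distrib_left)
  also have "\<dots> = (\<Sum>j<n. real j * (\<Sum>i<n. a j i))"
    by (intro sum.cong) (simp_all add: balanced)
  finally have zero: "(\<Sum>i<n. \<Sum>j<n. (real i - real j) * a i j) = 0" by simp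
  have "(\<Sum>i<n. \<Sum>j<n. if i < j then a i j else 0)
      = (\<Sum>i<n. \<Sum>j<n. (if i < j then a i j else 0) + (real i - real j) * a i j)"
    using zero by (simp add: sum.distrib)
  also have "\<dots> \<le> (\<Sum>i<n. \<Sum>j<n. (real n - 1) * (if j < i then a i j else 0))"
  proof (intro sum_mono)
    fix i j assume "i \<in> {..<n}" "j \<in> {..<n}"
    then consider "i < j" "1 + (real i - real j) \<le> 0" | "i = j" | "j < i" "real i - real j \<le> real n - 1"
      by fastforce
    then show "(if i < j then a i j else 0) + (real i - real j) * a i j
        \<le> (real n - 1) * (if j < i then a i j else 0)"
    proof cases
      case 1
      then have "(1 + (real i - real j)) * a i j \<le> 0"
        using nonneg by (simp add: mult_nonpos_nonneg)
      with 1 show ?thesis by (simp add: algebra_simps)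
    qed (use nonneg in \<open>auto intro: mult_right_mono\<close>)
  qed
  finally show ?thesis by (simp add: sum_distrib_left)
qed

section \<open>Unitary matrices and the Frobenius norm\<close>

lemma mat_adjoint_dim [simp]:
  "dim_row (mat_adjoint A) = dim_col A" "dim_col (mat_adjoint A) = dim_row A"
  by (simp_all add: mat_adjoint_def)

lemma mat_adjoint_index [simp]:
  "i < dim_col A \<Longrightarrow> j < dim_row A \<Longrightarrow> mat_adjoint A $$ (i, j) = conjugate (A $$ (j, i))"
  by (simp add: mat_adjoint_def mat_of_rows_index)

lemma mat_adjoint_carrier [simp]:
  "A \<in> carrier_mat n m \<Longrightarrow> mat_adjoint A \<in> carrier_mat m n"
  by auto

lemma mat_adjoint_mat_adjoint [simp]: "mat_adjoint (mat_adjoint A) = A"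
  by (rule eq_matI) auto

lemma mat_adjoint_mult:
  fixes A B :: "complex mat"
  assumes "A \<in> carrier_mat n m" "B \<in> carrier_mat m k"
  shows "mat_adjoint (A * B) = mat_adjoint B * mat_adjoint A"
  using assms by (intro eq_matI) (auto simp: scalar_prod_def mult.commute)

lemma mult_mat_assoc_inner:
  assumes "A \<in> carrier_mat k l" "B \<in> carrier_mat l m" "C \<in> carrier_mat m p" "D \<in> carrier_mat p q"
  shows "A * B * (C * D) = A * (B * C * D)"
  using assms assoc_mult_mat[of A k l B m "C * D" q] assoc_mult_mat[of B l m C p D q]
  by (simp del: assoc_mult_mat)

definition unitary :: "nat \<Rightarrow> complex mat \<Rightarrow> bool" where
  "unitary n U \<longleftrightarrow> U \<in> carrier_mat n n \<and> mat_adjoint U * U = 1\<^sub>m n"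

lemma unitaryD:
  assumes "unitary n U"
  shows "U \<in> carrier_mat n n" "mat_adjoint U \<in> carrier_mat n n"
    "mat_adjoint U * U = 1\<^sub>m n" "U * mat_adjoint U = 1\<^sub>m n"
  using assms mat_mult_left_right_inverse[of "mat_adjoint U" n U] by (auto simp: unitary_def)

lemma unitary_adjoint: "unitary n U \<Longrightarrow> unitary n (mat_adjoint U)"
  unfolding unitary_def mat_adjoint_mat_adjoint
  by (intro conjI unitaryD) (auto simp: unitary_def)

lemma unitary_mult:
  assumes "unitary n U" "unitary n V"
  shows "unitary n (U * V)"
proof -
  note U = unitaryD[OF assms(1)] and V = unitaryD[OF assms(2)]
  have "mat_adjoint (U * V) * (U * V) = mat_adjoint V * (mat_adjoint U * U * V)"
    using U(1,2) V(1,2) by (simp add: mat_adjoint_mult[of _ n n _ n] mult_mat_assoc_inner[of _ n n _ n _ n _ n] del: assoc_mult_mat)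
  also have "\<dots> = 1\<^sub>m n" using U(3) V by simp
  finally show ?thesis using U V by (simp add: unitary_def)
qed

lemma frobenius_norm_nonneg: "0 \<le> frobenius_norm A"
  by (simp add: frobenius_norm_def sum_nonneg)

lemma frobenius_norm_sq:
  "A \<in> carrier_mat n m \<Longrightarrow> (frobenius_norm A)\<^sup>2 = (\<Sum>i<n. \<Sum>j<m. (cmod (A $$ (i, j)))\<^sup>2)"
  by (auto simp: frobenius_norm_def intro!: real_sqrt_pow2 sum_nonneg)

lemma frobenius_norm_adjoint: "frobenius_norm (mat_adjoint A) = frobenius_norm A"
proof -
  have "(\<Sum>i<dim_col A. \<Sum>j<dim_row A. (cmod (mat_adjoint A $$ (i, j)))\<^sup>2)
      = (\<Sum>i<dim_col A. \<Sum>j<dim_row A. (cmod (A $$ (j, i)))\<^sup>2)"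
    by (intro sum.cong refl) simp
  also have "\<dots> = (\<Sum>i<dim_row A. \<Sum>j<dim_col A. (cmod (A $$ (i, j)))\<^sup>2)"
    by (rule sum.swap)
  finally show ?thesis by (simp add: frobenius_norm_def)
qed

text \<open>Frobenius norms are read off from \<open>A * mat_adjoint A\<close>, which turns unitary invariance and the
row-column balance of normal matrices into matrix identities.\<close>
lemma mult_adjoint_diag:
  assumes "A \<in> carrier_mat n m" "i < n"
  shows "(A * mat_adjoint A) $$ (i, i) = of_real (\<Sum>j<m. (cmod (A $$ (i, j)))\<^sup>2)"
proof -
  have "(A * mat_adjoint A) $$ (i, i) = (\<Sum>j<m. A $$ (i, j) * cnj (A $$ (i, j)))"
    using assms by (auto simp: scalar_prod_def atLeast0LessThan intro!: sum.cong)
  then show ?thesis by (simp only: of_real_sum complex_norm_square)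
qed

lemma frobenius_norm_mult_unitary:
  assumes A: "A \<in> carrier_mat m n" and U: "unitary n U"
  shows "frobenius_norm (A * U) = frobenius_norm A"
proof -
  note U = unitaryD[OF U]
  have "(A * U) * mat_adjoint (A * U) = A * (U * mat_adjoint U * mat_adjoint A)"
    using A U(1,2) by (simp add: mat_adjoint_mult[of _ m n _ n] mult_mat_assoc_inner[of A m n U n _ n _ m] del: assoc_mult_mat)
  then have eq: "(A * U) * mat_adjoint (A * U) = A * mat_adjoint A"
    using A U(4) by simp
  have "(\<Sum>j<n. (cmod ((A * U) $$ (i, j)))\<^sup>2) = (\<Sum>j<n. (cmod (A $$ (i, j)))\<^sup>2)" if "i < m" for i
    using mult_adjoint_diag[of "A * U" m n i] mult_adjoint_diag[of A m n i] A U(1) that eq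
    by (metis mult_carrier_mat of_real_eq_iff)
  then have "(frobenius_norm (A * U))\<^sup>2 = (frobenius_norm A)\<^sup>2"
    using A U(1) by (simp add: frobenius_norm_sq[of _ m n])
  then show ?thesis by (simp add: frobenius_norm_nonneg power2_eq_iff_nonneg)
qed

lemma frobenius_norm_unitary_mult:
  assumes A: "A \<in> carrier_mat n m" and U: "unitary n U"
  shows "frobenius_norm (U * A) = frobenius_norm A"
proof -
  have "frobenius_norm (U * A) = frobenius_norm (mat_adjoint A * mat_adjoint U)"
    using frobenius_norm_adjoint[of "U * A"] A unitaryD[OF U]
    by (simp add: mat_adjoint_mult[of _ n n _ m])
  also have "\<dots> = frobenius_norm A"
    using A U by (simp add: frobenius_norm_mult_unitary[of _ m n] unitary_adjoint frobenius_norm_adjoint)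
  finally show ?thesis .
qed

section \<open>Normal matrices and the Hoffman-Wielandt inequality\<close>

lemma normal_row_sum_eq_column_sum:
  assumes N: "N \<in> carrier_mat n n" and normal: "N * mat_adjoint N = mat_adjoint N * N"
    and i: "i < n"
  shows "(\<Sum>j<n. (cmod (N $$ (i, j)))\<^sup>2) = (\<Sum>j<n. (cmod (N $$ (j, i)))\<^sup>2)"
proof -
  have "(mat_adjoint N * N) $$ (i, i) = of_real (\<Sum>j<n. (cmod (mat_adjoint N $$ (i, j)))\<^sup>2)"
    using mult_adjoint_diag[of "mat_adjoint N" n n i] N i by simp
  then have "(\<Sum>j<n. (cmod (N $$ (i, j)))\<^sup>2) = (\<Sum>j<n. (cmod (mat_adjoint N $$ (i, j)))\<^sup>2)"
    using mult_adjoint_diag[OF N i] normal by (metis of_real_eq_iff)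
  also have "\<dots> = (\<Sum>j<n. (cmod (N $$ (j, i)))\<^sup>2)"
    using N i by (intro sum.cong) auto
  finally show ?thesis .
qed

text \<open>Replacing the upper triangular \<open>T\<close> by its diagonal loses control over the upper part of \<open>N\<close>, but for normal
\<open>N\<close> its squared norm is at most \<open>n - 1\<close> times that of the lower part, and \<open>T - N\<close> agrees with \<open>- N\<close> below the
diagonal. This is where the factor \<open>n\<close> comes from.\<close>
lemma normal_minus_diag_of_upper_triangular:
  assumes N: "N \<in> carrier_mat n n" and normal: "N * mat_adjoint N = mat_adjoint N * N"
    and T: "T \<in> carrier_mat n n" "upper_triangular T"
  shows "(frobenius_norm (mat_diag n (\<lambda>i. T $$ (i, i)) - N))\<^sup>2 \<le> real n * (frobenius_norm (T - N))\<^sup>2"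
proof -
  define a where "a i j = (cmod (N $$ (i, j)))\<^sup>2" for i j
  define b where "b i j = (cmod ((T - N) $$ (i, j)))\<^sup>2" for i j
  define L where "L = (\<Sum>i<n. \<Sum>j<n. if j < i then a i j else 0)"
  have lower: "b i j = a i j" if "j < i" "i < n" for i j
    using that N T by (simp add: a_def b_def upper_triangularD)
  have "(frobenius_norm (mat_diag n (\<lambda>i. T $$ (i, i)) - N))\<^sup>2
      = (\<Sum>i<n. \<Sum>j<n. (cmod ((mat_diag n (\<lambda>i. T $$ (i, i)) - N) $$ (i, j)))\<^sup>2)"
    using N by (intro frobenius_norm_sq) auto
  also have "\<dots> = (\<Sum>i<n. \<Sum>j<n. (if i < j then a i j else 0) +
      ((if j < i then a i j else 0) + (if i = j then b i j else 0)))"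
    using N T by (intro sum.cong refl) (auto simp: a_def b_def mat_diag_def)
  also have "\<dots> = (\<Sum>i<n. \<Sum>j<n. if i < j then a i j else 0) + (L + (\<Sum>i<n. b i i))"
    by (simp add: sum.distrib sum_sum_if_eq L_def)
  also have "(\<Sum>i<n. \<Sum>j<n. if i < j then a i j else 0) \<le> (real n - 1) * L"
    unfolding L_def using normal_row_sum_eq_column_sum[OF N normal]
    by (intro upper_sum_le_lower_sum) (auto simp: a_def)
  finally have "(frobenius_norm (mat_diag n (\<lambda>i. T $$ (i, i)) - N))\<^sup>2 \<le> real n * L + (\<Sum>i<n. b i i)"
    by (simp add: algebra_simps)
  also have "(\<Sum>i<n. b i i) \<le> real n * (\<Sum>i<n. b i i)"
    using mult_right_mono[of 1 "real n" "\<Sum>i<n. b i i"] sum_nonneg[of "{..<n}" "\<lambda>i. b i i"]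
    by (cases "n = 0") (auto simp: b_def)
  also have "real n * L + real n * (\<Sum>i<n. b i i)
      = real n * (\<Sum>i<n. \<Sum>j<n. (if j < i then a i j else 0) + (if i = j then b i j else 0))"
    by (simp add: sum.distrib sum_sum_if_eq L_def algebra_simps)
  also have "\<dots> \<le> real n * (\<Sum>i<n. \<Sum>j<n. b i j)"
    using lower by (intro mult_left_mono sum_mono) (auto simp: b_def)
  also have "(\<Sum>i<n. \<Sum>j<n. b i j) = (frobenius_norm (T - N))\<^sup>2"
    unfolding b_def using N T by (intro frobenius_norm_sq[symmetric]) auto
  finally show ?thesis by simp
qed

lemma unitary_sums:
  assumes U: "unitary n U" and k: "k < n"
  shows "(\<Sum>i<n. (cmod (U $$ (k, i)))\<^sup>2) = 1" "(\<Sum>i<n. (cmod (U $$ (i, k)))\<^sup>2) = 1"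
proof -
  have row: "(\<Sum>i<n. (cmod (V $$ (k, i)))\<^sup>2) = 1" if "unitary n V" for V
    using mult_adjoint_diag[of V n n k] unitaryD[OF that] k
    by (metis (no_types, lifting) index_one_mat(1) of_real_eq_1_iff)
  show "(\<Sum>i<n. (cmod (U $$ (k, i)))\<^sup>2) = 1" by (rule row[OF U])
  have "(\<Sum>i<n. (cmod (mat_adjoint U $$ (k, i)))\<^sup>2) = 1"
    by (rule row[OF unitary_adjoint[OF U]])
  then show "(\<Sum>i<n. (cmod (U $$ (i, k)))\<^sup>2) = 1"
    using unitaryD(1)[OF U] k by simp
qed

text \<open>The Hoffman-Wielandt theorem for the diagonal matrix of \<open>\<mu>\<close> and a normal matrix with eigenvalues \<open>d\<close>.
Multiplying the difference on the right by \<open>mat_adjoint U\<close> shows that its squared norm is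
\<open>\<Sum>k i. |\<mu> i - d k|\<^sup>2 * |U k i|\<^sup>2\<close>, an average of the matching costs with doubly stochastic weights.\<close>
lemma hoffman_wielandt_diag:
  assumes U: "unitary n U"
  shows "\<exists>\<sigma>. \<sigma> permutes {..<n} \<and> (\<Sum>k<n. (cmod (\<mu> (\<sigma> k) - d k))\<^sup>2)
    \<le> (frobenius_norm (mat_diag n \<mu> - mat_adjoint U * mat_diag n d * U))\<^sup>2"
proof -
  note Ud = unitaryD[OF U]
  let ?X = "mat_diag n \<mu> - mat_adjoint U * mat_diag n d * U"
  have dg: "mat_diag n f \<in> carrier_mat n n" for f :: "nat \<Rightarrow> complex" by simp
  have UD: "mat_adjoint U * mat_diag n d \<in> carrier_mat n n"
    by (rule mult_carrier_mat[OF Ud(2) dg])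
  have UDU: "mat_adjoint U * mat_diag n d * U \<in> carrier_mat n n"
    by (rule mult_carrier_mat[OF UD Ud(1)])
  have X: "?X \<in> carrier_mat n n" by (rule minus_carrier_mat[OF UDU])
  have "mat_adjoint U * mat_diag n d * U * mat_adjoint U
      = mat_adjoint U * mat_diag n d * (U * mat_adjoint U)"
    by (rule assoc_mult_mat[OF UD Ud(1,2)])
  also have "\<dots> = mat_adjoint U * mat_diag n d"
    unfolding Ud(4) by (rule right_mult_one_mat[OF UD])
  finally have "?X * mat_adjoint U = mat_diag n \<mu> * mat_adjoint U - mat_adjoint U * mat_diag n d"
    using minus_mult_distrib_mat[OF dg[of \<mu>] UDU Ud(2)] by (simp del: assoc_mult_mat)
  also have "\<dots> = mat n n (\<lambda>(i, k). (\<mu> i - d k) * cnj (U $$ (k, i)))"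
    using Ud(1,2) mat_diag_mult_left[of "mat_adjoint U" n n \<mu>] mat_diag_mult_right[of "mat_adjoint U" n n d]
    by (intro eq_matI) (auto simp: algebra_simps)
  finally have "(frobenius_norm ?X)\<^sup>2
      = (frobenius_norm (mat n n (\<lambda>(i, k). (\<mu> i - d k) * cnj (U $$ (k, i)))))\<^sup>2"
    using frobenius_norm_mult_unitary[OF X unitary_adjoint[OF U]] by simp
  also have "\<dots> = (\<Sum>i<n. \<Sum>k<n. (cmod (\<mu> i - d k))\<^sup>2 * (cmod (U $$ (k, i)))\<^sup>2)"
    by (subst frobenius_norm_sq[of _ n n]) (auto simp: norm_mult power_mult_distrib)
  also have "\<dots> = (\<Sum>k<n. \<Sum>i<n. (cmod (\<mu> i - d k))\<^sup>2 * (cmod (U $$ (k, i)))\<^sup>2)"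
    by (rule sum.swap)
  finally have eq: "(frobenius_norm ?X)\<^sup>2 = \<dots>" .
  show ?thesis unfolding eq
    by (rule doubly_stochastic_assignment) (use unitary_sums[OF U] in auto)
qed

section \<open>Unitary triangularization\<close>

text \<open>Complete \<open>v\<close> to a basis, apply Gram-Schmidt, and divide each column by its length.\<close>
lemma unitary_with_first_column:
  fixes v :: "complex vec"
  assumes v: "v \<in> carrier_vec n" and v0: "v \<noteq> 0\<^sub>v n" and n: "0 < n"
  shows "\<exists>U c. unitary n U \<and> col U 0 = c \<cdot>\<^sub>v v"
proof -
  interpret cof_vec_space n "TYPE(complex)" .
  note bc = basis_completion[OF v v0]
  define ws where "ws = gram_schmidt n (basis_completion v)"
  have ws: "set ws \<subseteq> carrier_vec n" "corthogonal ws" "length ws = n"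
    using gram_schmidt_result[OF bc(2,4,5) ws_def] bc(6) by auto
  obtain vs where "basis_completion v = v # vs"
    using bc(6,7) n by (cases "basis_completion v") auto
  then have "hd ws = v" unfolding ws_def using gram_schmidt_hd[OF v] by simp
  then have ws0: "ws ! 0 = v" using ws(3) n by (metis hd_conv_nth length_greater_0_conv)
  have car: "ws ! j \<in> carrier_vec n" if "j < n" for j
    using ws that by auto
  define r where "r j = sqrt (\<Sum>i<n. (cmod (ws ! j $ i))\<^sup>2)" for j
  have inner: "ws ! j \<bullet>c ws ! k = (\<Sum>i<n. ws ! j $ i * cnj (ws ! k $ i))" if "j < n" "k < n" for j k
    using car[OF that(1)] car[OF that(2)] by (simp add: scalar_prod_def atLeast0LessThan)
  have self: "ws ! j \<bullet>c ws ! j = of_real ((r j)\<^sup>2)" if "j < n" for j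
    unfolding inner[OF that that] r_def
    by (simp add: sum_nonneg complex_norm_square[symmetric] del: of_real_power)
  have r0: "r j \<noteq> 0" if "j < n" for j
    using self[OF that] corthogonalD[OF ws(2), of j j] ws(3) that by auto
  define U where "U = mat n n (\<lambda>(i, j). ws ! j $ i / of_real (r j))"
  have U: "U \<in> carrier_mat n n" by (simp add: U_def)
  have "mat_adjoint U * U = 1\<^sub>m n"
  proof (rule eq_matI)
    fix j k assume "j < dim_row (1\<^sub>m n)" "k < dim_col (1\<^sub>m n)"
    then have jk: "j < n" "k < n" by auto
    have "(mat_adjoint U * U) $$ (j, k) = (\<Sum>i<n. cnj (U $$ (i, j)) * U $$ (i, k))"
      using U jk by (auto simp: scalar_prod_def atLeast0LessThan)
    also have "\<dots> = (\<Sum>i<n. (ws ! k $ i * cnj (ws ! j $ i)) / of_real (r j * r k))"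
      using jk by (intro sum.cong) (auto simp: U_def)
    also have "\<dots> = (ws ! k \<bullet>c ws ! j) / of_real (r j * r k)"
      using jk by (simp add: inner sum_divide_distrib)
    also have "\<dots> = 1\<^sub>m n $$ (j, k)"
    proof (cases "j = k")
      case True
      then show ?thesis using self[OF jk(2)] r0[OF jk(2)] jk by (simp add: power2_eq_square)
    next
      case False
      then show ?thesis using corthogonalD[OF ws(2), of k j] ws(3) jk by simp
    qed
    finally show "(mat_adjoint U * U) $$ (j, k) = 1\<^sub>m n $$ (j, k)" .
  qed (use U in auto)
  moreover have "col U 0 = (1 / of_real (r 0)) \<cdot>\<^sub>v v"
    using n v ws0 by (intro eq_vecI) (auto simp: U_def)
  ultimately show ?thesis using U unitary_def by blast
qed

lemma mat_adjoint_four_block_diag: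
  fixes A D :: "complex mat"
  assumes "A \<in> carrier_mat a a" "D \<in> carrier_mat d d"
  shows "mat_adjoint (four_block_mat A (0\<^sub>m a d) (0\<^sub>m d a) D)
    = four_block_mat (mat_adjoint A) (0\<^sub>m a d) (0\<^sub>m d a) (mat_adjoint D)"
  using assms by (intro eq_matI) (auto simp: mat_adjoint_def mat_of_rows_index)

text \<open>Schur triangularization by a unitary matrix, by deflation: a unitary matrix with a unit eigenvector as its
first column splits off a one-dimensional block, and the induction hypothesis applies to the remaining block.\<close>
lemma unitary_schur:
  fixes A :: "complex mat"
  assumes "A \<in> carrier_mat n n" and "char_poly A = (\<Prod>e\<leftarrow>es. [:- e, 1:])"
  shows "\<exists>U T. unitary n U \<and> T \<in> carrier_mat n n \<and> upper_triangular T \<and> diag_mat T = es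
    \<and> A = U * T * mat_adjoint U"
  using assms
proof (induction es arbitrary: n A)
  case Nil
  then have "n = 0" using degree_monic_char_poly[of A n] by simp
  then show ?case using Nil(1)
    by (intro exI[of _ "1\<^sub>m 0"] exI[of _ A]) (auto simp: unitary_def diag_mat_def intro!: eq_matI)
next
  case (Cons e es)
  note A = Cons.prems(1)
  have ev: "eigenvalue A e"
    unfolding eigenvalue_root_char_poly[OF A] Cons.prems(2) by simp
  obtain v where v: "v \<in> carrier_vec n" "v \<noteq> 0\<^sub>v n" "A *\<^sub>v v = e \<cdot>\<^sub>v v"
    using ev A unfolding eigenvalue_def eigenvector_def by auto
  have n: "n \<noteq> 0"
  proof
    assume "n = 0"
    then have "v = 0\<^sub>v n" using v(1) by (intro eq_vecI) auto
    with v(2) show False ..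
  qed
  then obtain k where k: "n = Suc k" by (cases n) auto
  \<comment> \<open>the first column of \<open>U\<close> is again an eigenvector for \<open>e\<close>, so the first column of \<open>A'\<close> is \<open>e\<close> times a unit vector\<close>
  obtain U c where U: "unitary n U" and Uc: "col U 0 = c \<cdot>\<^sub>v v"
    using unitary_with_first_column[OF v(1,2)] n by auto
  note Ud = unitaryD[OF U]
  have Aev: "A *\<^sub>v col U 0 = e \<cdot>\<^sub>v col U 0"
    unfolding Uc using A v by (auto simp: mult_mat_vec smult_smult_assoc mult.commute)
  define A' where "A' = mat_adjoint U * (A * U)"
  have A': "A' \<in> carrier_mat n n" unfolding A'_def using A Ud by auto
  have col0: "A' $$ (i, 0) = (if i = 0 then e else 0)" if i: "i < n" for i
  proof -
    have "A' $$ (i, 0) = row (mat_adjoint U) i \<bullet> col (A * U) 0"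
      unfolding A'_def using Ud(1,2) A i n by (subst index_mult_mat) auto
    also have "col (A * U) 0 = A *\<^sub>v col U 0"
      using A Ud(1) n by (subst col_mult2) auto
    also have "row (mat_adjoint U) i \<bullet> (A *\<^sub>v col U 0) = e * (row (mat_adjoint U) i \<bullet> col U 0)"
      unfolding Aev using Ud(1,2) i n by (subst scalar_prod_smult_distrib[of _ n]) auto
    also have "row (mat_adjoint U) i \<bullet> col U 0 = (mat_adjoint U * U) $$ (i, 0)"
      using Ud(1,2) i n by (subst index_mult_mat) auto
    finally show ?thesis using Ud(3) i n by simp
  qed
  obtain A1 A2 A0 A3 where split: "split_block A' 1 1 = (A1, A2, A0, A3)"
    by (cases "split_block A' 1 1") auto
  have blocks: "A1 \<in> carrier_mat 1 1" "A2 \<in> carrier_mat 1 k" "A0 \<in> carrier_mat k 1" "A3 \<in> carrier_mat k k"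
    "A' = four_block_mat A1 A2 A0 A3"
    using split_block[OF split, of k k] A' k by auto
  have A1e: "A1 = mat 1 1 (\<lambda>_. e)"
    using split col0[of 0] n unfolding split_block_def Let_def by auto
  have A00: "A0 = 0\<^sub>m k 1"
    using split col0 k A' unfolding split_block_def Let_def by (auto intro!: eq_matI)
  have AA': "A = U * A' * mat_adjoint U"
  proof -
    have "U * A' = U * mat_adjoint U * (A * U)"
      unfolding A'_def using A Ud(1,2) by (subst assoc_mult_mat[of U n n "mat_adjoint U" n]) auto
    also have "\<dots> = A * U" unfolding Ud(4) using A Ud(1) by simp
    finally have "U * A' * mat_adjoint U = A * (U * mat_adjoint U)"
      using assoc_mult_mat[OF A Ud(1,2)] by simp
    then show ?thesis unfolding Ud(4) using A by simp
  qed
  have "similar_mat A A'"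
    by (rule similar_matI[of _ _ U "mat_adjoint U" n]) (use A A' Ud AA' in auto)
  then have "char_poly A' = char_poly A" using char_poly_similar by metis
  moreover have "char_poly A' = char_poly A1 * char_poly A3"
    unfolding blocks(5) A00 by (rule char_poly_four_block_zeros_col[OF blocks(1,2,4)])
  moreover have "char_poly A1 = [:- e, 1:]"
    by (simp add: A1e char_poly_defs det_def sign_def)
  ultimately have "[:- e, 1:] * char_poly A3 = [:- e, 1:] * (\<Prod>e\<leftarrow>es. [:- e, 1:])"
    using Cons.prems(2) by simp
  then have "char_poly A3 = (\<Prod>e\<leftarrow>es. [:- e, 1:])"
    by (metis mult_cancel_left pCons_eq_0_iff zero_neq_one)
  from Cons.IH[OF blocks(4) this] obtain V T where V: "unitary k V" and T: "T \<in> carrier_mat k k"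
    "upper_triangular T" "diag_mat T = es" and A3: "A3 = V * T * mat_adjoint V" by blast
  note Vd = unitaryD[OF V]
  \<comment> \<open>triangularize the lower block and leave the split-off coordinate alone\<close>
  define W where "W = four_block_mat (1\<^sub>m 1) (0\<^sub>m 1 k) (0\<^sub>m k 1) V"
  define C where "C = four_block_mat A1 (A2 * V) (0\<^sub>m k 1) T"
  have C: "C \<in> carrier_mat n n"
    unfolding C_def k using four_block_carrier_mat[OF blocks(1) T(1)] by simp
  have adjW: "mat_adjoint W = four_block_mat (1\<^sub>m 1) (0\<^sub>m 1 k) (0\<^sub>m k 1) (mat_adjoint V)"
    unfolding W_def using Vd(1) by (subst mat_adjoint_four_block_diag) (auto intro!: arg_cong4[where f = four_block_mat] eq_matI)
  have W: "W \<in> carrier_mat n n"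
    unfolding W_def k using four_block_carrier_mat[OF one_carrier_mat[of 1] Vd(1)] by simp
  have one: "1\<^sub>m n = four_block_mat (1\<^sub>m 1) (0\<^sub>m 1 k) (0\<^sub>m k 1) (1\<^sub>m k)"
    unfolding k by (intro eq_matI) auto
  have "mat_adjoint W * W = 1\<^sub>m n"
    unfolding adjW unfolding W_def one using Vd
    by (subst mult_four_block_mat[of _ 1 1 _ k _ k _ _ 1 _ k]) auto
  then have uW: "unitary n W" using W by (simp add: unitary_def)
  have "W * C = four_block_mat A1 (A2 * V) (0\<^sub>m k 1) (V * T)"
    unfolding W_def C_def using Vd blocks T(1)
    by (subst mult_four_block_mat[of _ 1 1 _ k _ k _ _ 1 _ k]) auto
  then have "W * C * mat_adjoint W = four_block_mat A1 (A2 * V * mat_adjoint V) (0\<^sub>m k 1) (V * T * mat_adjoint V)"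
    unfolding adjW using Vd(1,2) blocks(1,2) T(1)
    by (simp del: assoc_mult_mat, subst mult_four_block_mat[of _ 1 1 _ k _ k _ _ 1 _ k]) (auto simp del: assoc_mult_mat)
  also have "A2 * V * mat_adjoint V = A2"
    using assoc_mult_mat[OF blocks(2) Vd(1,2)] Vd(4) blocks(2) by simp
  finally have A'C: "A' = W * C * mat_adjoint W"
    unfolding blocks(5) A00 A3 by simp
  note Wd = unitaryD[OF uW]
  have WC: "W * C \<in> carrier_mat n n" by (rule mult_carrier_mat[OF W C])
  have "U * A' = U * W * C * mat_adjoint W"
    unfolding A'C assoc_mult_mat[OF Ud(1) W C] by (rule assoc_mult_mat[OF Ud(1) WC Wd(2), symmetric])
  then have "A = U * W * C * (mat_adjoint W * mat_adjoint U)"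
    using AA' assoc_mult_mat[OF mult_carrier_mat[OF mult_carrier_mat[OF Ud(1) W] C] Wd(2) Ud(2)] by simp
  then have "A = U * W * C * mat_adjoint (U * W)"
    unfolding mat_adjoint_mult[OF Ud(1) W] .
  moreover have "upper_triangular C"
    unfolding C_def by (rule upper_triangular_four_block[OF blocks(1) T(1) _ T(2)]) (auto simp: A1e)
  moreover have "diag_mat C = e # es"
    unfolding C_def diag_four_block_mat[OF blocks(1) T(1)] T(3) by (simp add: A1e diag_mat_def)
  ultimately show ?case using unitary_mult[OF U uW] C by blast
qed

section \<open>Eigenvalue variation from a diagonal matrix, and the trace\<close>

lemma unitary_conj_mult:
  assumes U: "unitary n U" and X: "X \<in> carrier_mat n n" and Y: "Y \<in> carrier_mat n n"
  shows "(mat_adjoint U * X * U) * (mat_adjoint U * Y * U) = mat_adjoint U * (X * Y) * U"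
proof -
  note Ud = unitaryD[OF U]
  have UX: "mat_adjoint U * X \<in> carrier_mat n n" by (rule mult_carrier_mat[OF Ud(2) X])
  have YU: "Y * U \<in> carrier_mat n n" by (rule mult_carrier_mat[OF Y Ud(1)])
  have "(mat_adjoint U * X * U) * (mat_adjoint U * Y * U) = mat_adjoint U * X * U * (mat_adjoint U * (Y * U))"
    using assoc_mult_mat[OF Ud(2) Y Ud(1)] by simp
  also have "\<dots> = mat_adjoint U * X * (U * mat_adjoint U * (Y * U))"
    by (rule mult_mat_assoc_inner[OF UX Ud(1,2) YU])
  also have "\<dots> = mat_adjoint U * X * (Y * U)"
    unfolding Ud(4) using left_mult_one_mat[OF YU] by simp
  also have "\<dots> = mat_adjoint U * (X * Y * U)"
    by (rule mult_mat_assoc_inner[OF Ud(2) X Y Ud(1)])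
  also have "\<dots> = mat_adjoint U * (X * Y) * U"
    by (rule assoc_mult_mat[symmetric, OF Ud(2) mult_carrier_mat[OF X Y] Ud(1)])
  finally show ?thesis .
qed

lemma unitary_conj_adjoint:
  assumes U: "unitary n U" and X: "X \<in> carrier_mat n n"
  shows "mat_adjoint (mat_adjoint U * X * U) = mat_adjoint U * mat_adjoint X * U"
proof -
  note Ud = unitaryD[OF U]
  have "mat_adjoint (mat_adjoint U * X * U) = mat_adjoint U * (mat_adjoint X * U)"
    using mat_adjoint_mult[OF mult_carrier_mat[OF Ud(2) X] Ud(1)] mat_adjoint_mult[OF Ud(2) X] by simp
  then show ?thesis
    using assoc_mult_mat[OF Ud(2) mat_adjoint_carrier[OF X] Ud(1)] by simp
qed

text \<open>Eigenvalue variation from a diagonal (up to unitary similarity: a normal) matrix to an arbitrary one. In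
the Schur basis of \<open>M\<close> the diagonal matrix becomes a normal matrix \<open>N\<close>. Comparing \<open>N\<close> with the diagonal
of the triangular factor instead of the factor itself costs the factor \<open>n\<close>, after which
Hoffman-Wielandt applies.\<close>
lemma eigenvalue_variation_diag:
  assumes M: "M \<in> carrier_mat n n" and cp: "char_poly M = (\<Prod>e\<leftarrow>map \<mu> [0..<n]. [:- e, 1:])"
  shows "\<exists>\<sigma>. \<sigma> permutes {..<n} \<and>
    (\<Sum>k<n. (cmod (\<mu> (\<sigma> k) - d k))\<^sup>2) \<le> real n * (frobenius_norm (M - mat_diag n d))\<^sup>2"
proof -
  obtain U T where U: "unitary n U" and T: "T \<in> carrier_mat n n" "upper_triangular T"
    "diag_mat T = map \<mu> [0..<n]" and MT: "M = U * T * mat_adjoint U"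
    using unitary_schur[OF M cp] by blast
  note Ud = unitaryD[OF U]
  define D where "D = mat_diag n d"
  have D: "D \<in> carrier_mat n n" by (simp add: D_def)
  define N where "N = mat_adjoint U * D * U"
  have UD: "mat_adjoint U * D \<in> carrier_mat n n" by (rule mult_carrier_mat[OF Ud(2) D])
  have N: "N \<in> carrier_mat n n" unfolding N_def by (rule mult_carrier_mat[OF UD Ud(1)])
  have "mat_adjoint D = mat_diag n (\<lambda>i. cnj (d i))"
    unfolding D_def by (intro eq_matI) (auto simp: mat_diag_def)
  then have "D * mat_adjoint D = mat_adjoint D * D"
    by (simp add: D_def mult.commute)
  then have normal: "N * mat_adjoint N = mat_adjoint N * N"
    unfolding N_def unitary_conj_adjoint[OF U D]
    using unitary_conj_mult[OF U D mat_adjoint_carrier[OF D]]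
      unitary_conj_mult[OF U mat_adjoint_carrier[OF D] D] by simp
  have "T $$ (i, i) = \<mu> i" if "i < n" for i
    using arg_cong[OF T(3), of "\<lambda>l. l ! i"] T(1) that by (simp add: diag_mat_def)
  then have diagT: "mat_diag n (\<lambda>i. T $$ (i, i)) = mat_diag n \<mu>"
    by (intro eq_matI) (auto simp: mat_diag_def)
  have MU: "mat_adjoint U * M * U = T"
  proof -
    have "mat_adjoint U * M = mat_adjoint U * U * (T * mat_adjoint U)"
      unfolding MT using assoc_mult_mat[OF Ud(1) T(1) Ud(2)]
        assoc_mult_mat[OF Ud(2,1) mult_carrier_mat[OF T(1) Ud(2)]] by simp
    also have "\<dots> = T * mat_adjoint U"
      unfolding Ud(3) by (rule left_mult_one_mat[OF mult_carrier_mat[OF T(1) Ud(2)]])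
    finally have "mat_adjoint U * M * U = T * (mat_adjoint U * U)"
      using assoc_mult_mat[OF T(1) Ud(2,1)] by simp
    then show ?thesis unfolding Ud(3) using T(1) by simp
  qed
  have "mat_adjoint U * (M - D) * U = T - N"
    unfolding mult_minus_distrib_mat[OF Ud(2) M D]
      minus_mult_distrib_mat[OF mult_carrier_mat[OF Ud(2) M] UD Ud(1)] MU N_def ..
  moreover have "frobenius_norm (mat_adjoint U * (M - D) * U) = frobenius_norm (M - D)"
    using frobenius_norm_mult_unitary[OF mult_carrier_mat[OF Ud(2) minus_carrier_mat[OF D]] U, of M]
      frobenius_norm_unitary_mult[OF minus_carrier_mat[OF D] unitary_adjoint[OF U], of M] by simp
  ultimately have "(frobenius_norm (mat_diag n \<mu> - N))\<^sup>2 \<le> real n * (frobenius_norm (M - D))\<^sup>2"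
    using normal_minus_diag_of_upper_triangular[OF N normal T(1,2)] unfolding diagT by simp
  then show ?thesis
    using hoffman_wielandt_diag[OF U, of \<mu> d] unfolding N_def D_def by (meson order_trans)
qed

lemma mat_trace_mult_commute:
  assumes "A \<in> carrier_mat n m" "B \<in> carrier_mat m n"
  shows "mat_trace (A * B) = mat_trace (B * A)"
proof -
  have "mat_trace (A * B) = (\<Sum>i<n. \<Sum>j<m. A $$ (i, j) * B $$ (j, i))"
    using assms by (auto simp: mat_trace_def scalar_prod_def atLeast0LessThan intro!: sum.cong)
  also have "\<dots> = (\<Sum>j<m. \<Sum>i<n. B $$ (j, i) * A $$ (i, j))"
    by (subst sum.swap) (simp add: mult.commute)
  also have "\<dots> = mat_trace (B * A)"
    using assms by (auto simp: mat_trace_def scalar_prod_def atLeast0LessThan intro!: sum.cong)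
  finally show ?thesis .
qed

lemma mat_trace_similar:
  assumes "P \<in> carrier_mat n n" "B \<in> carrier_mat n n" "Q \<in> carrier_mat n n" "Q * P = 1\<^sub>m n"
  shows "mat_trace (P * B * Q) = mat_trace B"
proof -
  have "mat_trace (P * B * Q) = mat_trace (Q * (P * B))"
    by (rule mat_trace_mult_commute[of _ n n]) (use assms in auto)
  also have "Q * (P * B) = B"
    using assoc_mult_mat[OF assms(3,1,2), symmetric] assms by simp
  finally show ?thesis .
qed

lemma mat_trace_eq_sum_eigenvalues:
  assumes M: "M \<in> carrier_mat n n" and cp: "char_poly M = (\<Prod>e\<leftarrow>map \<mu> [0..<n]. [:- e, 1:])"
  shows "mat_trace M = (\<Sum>i<n. \<mu> i)"
proof -
  obtain U T where U: "unitary n U" and T: "T \<in> carrier_mat n n"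
    "diag_mat T = map \<mu> [0..<n]" and MT: "M = U * T * mat_adjoint U"
    using unitary_schur[OF M cp] by blast
  have "T $$ (i, i) = \<mu> i" if "i < n" for i
    using arg_cong[OF T(2), of "\<lambda>l. l ! i"] T(1) that by (simp add: diag_mat_def)
  then have "mat_trace T = (\<Sum>i<n. \<mu> i)" using T(1) by (simp add: mat_trace_def)
  moreover have "mat_trace M = mat_trace T"
    unfolding MT by (rule mat_trace_similar[OF unitaryD(1)[OF U] T(1) unitaryD(2,3)[OF U]])
  ultimately show ?thesis by simp
qed

section \<open>Jordan matrices and spectra in coordinates\<close>

text \<open>A coordinate description of the Jordan matrix: \<open>d\<close> lists the diagonal, \<open>C\<close> is the set of rows that have a
one on the superdiagonal, and \<open>s i\<close> is the position of \<open>i\<close> within its block, counted from \<open>0\<close>. Each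
block loses exactly one superdiagonal one, so \<open>card C\<close> is the size minus the number of blocks.\<close>
lemma jordan_matrix_structure:
  fixes Js :: "(nat \<times> complex) list"
  assumes "\<forall>(k, a) \<in> set Js. 1 \<le> k \<and> k \<le> m"
  shows "\<exists>d C s. let n = sum_list (map fst Js) in
    diag_block_mat (map (\<lambda>(k, a). jordan_block k a) Js)
      = mat n n (\<lambda>(i, j). (if i = j then d i else 0) + (if Suc i = j \<and> i \<in> C then 1 else 0))
    \<and> (\<forall>i\<in>C. Suc i < n \<and> s (Suc i) = Suc (s i)) \<and> (\<forall>i<n. s i < m) \<and> card C + length Js = n"
  using assms
proof (induction Js)
  case Nil
  show ?case by (intro exI[of _ "{}"] exI) (auto intro!: eq_matI)
next
  case (Cons p Js)
  obtain k a where p: "p = (k, a)" by (cases p)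
  define n where "n = sum_list (map fst Js)"
  define B where "B = diag_block_mat (map (\<lambda>(k, a). jordan_block k a) Js)"
  have k: "1 \<le> k" "k \<le> m" using Cons.prems p by auto
  have "\<exists>d C s. B = mat n n (\<lambda>(i, j). (if i = j then d i else 0) + (if Suc i = j \<and> i \<in> C then 1 else 0))
      \<and> (\<forall>i\<in>C. Suc i < n \<and> s (Suc i) = Suc (s i)) \<and> (\<forall>i<n. s i < m) \<and> card C + length Js = n"
    using Cons.IH Cons.prems unfolding Let_def n_def[symmetric] B_def[symmetric] by simp
  then obtain d C s where B: "B = mat n n (\<lambda>(i, j). (if i = j then d i else 0) + (if Suc i = j \<and> i \<in> C then 1 else 0))"
    and C: "\<And>i. i \<in> C \<Longrightarrow> Suc i < n" "\<And>i. i \<in> C \<Longrightarrow> s (Suc i) = Suc (s i)"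
    and s: "\<And>i. i < n \<Longrightarrow> s i < m" and card: "card C + length Js = n"
    by blast
  define d' where "d' i = (if i < k then a else d (i - k))" for i
  define C' where "C' = {..<k - 1} \<union> (\<lambda>i. i + k) ` C"
  define s' where "s' i = (if i < k then i else s (i - k))" for i
  have inC': "i \<in> C' \<longleftrightarrow> (if i < k then Suc i < k else i - k \<in> C)" for i
    by (force simp: C'_def image_iff)
  have dims: "dim_row B = n" "dim_col B = n" by (auto simp: B)
  have "diag_block_mat (map (\<lambda>(k, a). jordan_block k a) (p # Js))
      = four_block_mat (jordan_block k a) (0\<^sub>m k n) (0\<^sub>m n k) B"
    by (simp add: p B_def[symmetric] dims Let_def)
  also have "\<dots> = mat (k + n) (k + n)
      (\<lambda>(i, j). (if i = j then d' i else 0) + (if Suc i = j \<and> i \<in> C' then 1 else 0))"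
    using dims by (intro eq_matI) (auto simp: B inC' d'_def Suc_diff_le)
  finally have 1: "diag_block_mat (map (\<lambda>(k, a). jordan_block k a) (p # Js)) = \<dots>" .
  have 2: "\<forall>i\<in>C'. Suc i < k + n \<and> s' (Suc i) = Suc (s' i)"
    using C by (fastforce simp: C'_def s'_def Suc_diff_le)
  have 3: "\<forall>i<k + n. s' i < m"
    using s k by (auto simp: s'_def)
  have "finite C" using C(1) by (intro finite_subset[of C "{..<n}"]) (auto dest: Suc_lessD)
  then have "card C' = (k - 1) + card C"
    unfolding C'_def by (subst card_Un_disjoint) (auto simp: card_image inj_on_def)
  then have "card C' + length (p # Js) = k + n"
    using card k by simp
  with 1 2 3 show ?case
    by (intro exI[of _ d'] exI[of _ C'] exI[of _ s']) (simp add: p n_def Let_def)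
qed

lemma spectrum_listing_mset:
  assumes "spectrum_listing n A l" and cp: "char_poly A = (\<Prod>e\<leftarrow>es. [:- e, 1:])"
  shows "image_mset l (mset_set {1..n}) = mset es"
proof (rule multiset_eqI)
  fix z
  have "Polynomial.order z (\<Prod>e\<leftarrow>es. [:- e, 1:]) = sum_list (map (Polynomial.order z) (map (\<lambda>e. [:- e, 1:]) es))"
    by (rule order_prod_list) auto
  also have "\<dots> = count (mset es) z"
    by (induction es) (auto simp: order_linear')
  finally have "card {i \<in> {1..n}. l i = z} = count (mset es) z"
    using assms unfolding spectrum_listing_def by simp
  moreover have "count (image_mset l (mset_set {1..n})) z = card (l -` {z} \<inter> {1..n})"
    by (simp add: count_image_mset)
  moreover have "l -` {z} \<inter> {1..n} = {i \<in> {1..n}. l i = z}" by auto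
  ultimately show "count (image_mset l (mset_set {1..n})) z = count (mset es) z"
    by simp
qed

text \<open>Over the complex numbers the characteristic polynomial splits, so it is determined by the multiset of its
roots, and every listing of the spectrum factorizes it.\<close>
lemma spectrum_listing_char_poly:
  assumes l: "spectrum_listing n A l" and A: "A \<in> carrier_mat n n"
  shows "char_poly A = (\<Prod>e\<leftarrow>map (\<lambda>i. l (Suc i)) [0..<n]. [:- e, 1:])"
proof -
  obtain es where es: "char_poly A = (\<Prod>e\<leftarrow>es. [:- e, 1:])"
    using char_poly_factorized[OF A] by blast
  have "mset es = image_mset l (mset_set {1..n})"
    using spectrum_listing_mset[OF l es] by simp
  also have "{1..n} = Suc ` {..<n}" by (auto simp: image_iff Suc_le_eq gr0_conv_Suc)
  also have "mset_set (Suc ` {..<n}) = image_mset Suc (mset_set {..<n})"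
    by (rule image_mset_mset_set[symmetric]) simp
  also have "image_mset l \<dots> = mset (map (\<lambda>i. l (Suc i)) [0..<n])"
    by (simp add: multiset.map_comp o_def lessThan_atLeast0)
  finally have "mset es = mset (map (\<lambda>i. l (Suc i)) [0..<n])" .
  then have "prod_mset (image_mset (\<lambda>e. [:- e, 1:]) (mset es))
      = prod_mset (image_mset (\<lambda>e. [:- e, 1:]) (mset (map (\<lambda>i. l (Suc i)) [0..<n])))"
    by simp
  then show ?thesis unfolding es by (simp only: mset_map[symmetric] prod_mset_prod_list)
qed

section \<open>Scaling a perturbed Jordan matrix\<close>

lemma sum_le_sqrt_card_mult:
  fixes f :: "'a \<Rightarrow> real"
  shows "(\<Sum>i\<in>C. \<bar>f i\<bar>) \<le> sqrt (real (card C)) * sqrt (\<Sum>i\<in>C. (f i)\<^sup>2)"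
  using L2_set_mult_ineq[of "\<lambda>_. 1" f C] by (simp add: L2_set_def)

text \<open>The perturbation after the diagonal scaling that replaces the superdiagonal ones by \<open>\<epsilon>\<close>. Scaling enlarges a
general entry of \<open>G\<close> by a factor of at most \<open>1 / \<epsilon> ^ (m - 1)\<close>, because all positions \<open>s i\<close> lie
between \<open>0\<close> and \<open>m - 1\<close>. The entries that meet a superdiagonal one are instead multiplied by \<open>\<epsilon>\<close>, so the mixed term
carries the factor \<open>\<epsilon>\<^sup>2\<close>; the triangle inequality for the Frobenius norms would lose this.\<close>
lemma scaled_perturbation_bound:
  fixes G :: "complex mat" and \<epsilon> :: real
  assumes G: "G \<in> carrier_mat n n" and \<epsilon>: "0 < \<epsilon>" "\<epsilon> \<le> 1"
    and C: "\<And>i. i \<in> C \<Longrightarrow> Suc i < n" "\<And>i. i \<in> C \<Longrightarrow> s (Suc i) = Suc (s i)"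
    and s: "\<And>i. i < n \<Longrightarrow> s i < m"
  shows "(\<Sum>i<n. \<Sum>j<n. (\<epsilon> ^ s j / \<epsilon> ^ s i * cmod ((if Suc i = j \<and> i \<in> C then 1 else 0) + G $$ (i, j)))\<^sup>2)
    \<le> \<epsilon>\<^sup>2 * (real (card C) + 2 * sqrt (real (card C)) * frobenius_norm G)
      + (frobenius_norm G / \<epsilon> ^ (m - 1))\<^sup>2"
proof -
  define g where "g i j = cmod (G $$ (i, j))" for i j
  have finC: "finite C" using C(1) by (intro finite_subset[of C "{..<n}"]) (auto dest: Suc_lessD)
  have ratio: "\<epsilon> ^ s j / \<epsilon> ^ s i \<le> 1 / \<epsilon> ^ (m - 1)" if "i < n" for i j
  proof (intro frac_le)
    show "\<epsilon> ^ (m - 1) \<le> \<epsilon> ^ s i" using s[OF that] \<epsilon> by (intro power_decreasing) auto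
  qed (use \<epsilon> in \<open>auto intro: power_le_one\<close>)
  have entry: "(\<epsilon> ^ s j / \<epsilon> ^ s i * cmod ((if Suc i = j \<and> i \<in> C then 1 else 0) + G $$ (i, j)))\<^sup>2
      \<le> (if Suc i = j \<and> i \<in> C then \<epsilon>\<^sup>2 * (1 + 2 * g i j) else 0) + (g i j / \<epsilon> ^ (m - 1))\<^sup>2"
    if ij: "i < n" "j < n" for i j
  proof -
    define r where "r = \<epsilon> ^ s j / \<epsilon> ^ s i"
    have r: "0 \<le> r" "r \<le> 1 / \<epsilon> ^ (m - 1)" using \<epsilon> ratio[OF ij(1)] by (auto simp: r_def)
    have rg: "(r * g i j)\<^sup>2 \<le> (g i j / \<epsilon> ^ (m - 1))\<^sup>2"
      using mult_right_mono[OF r(2), of "g i j"] r(1) by (intro power_mono) (auto simp: g_def)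
    show ?thesis
    proof (cases "Suc i = j \<and> i \<in> C")
      case True
      then have re: "r = \<epsilon>" using C(2) \<epsilon> by (auto simp: r_def)
      have "(r * cmod (1 + G $$ (i, j)))\<^sup>2 \<le> (r * (1 + g i j))\<^sup>2"
        using r(1) norm_triangle_ineq[of 1 "G $$ (i, j)"]
        by (intro power_mono mult_left_mono) (auto simp: g_def)
      also have "\<dots> = \<epsilon>\<^sup>2 * (1 + 2 * g i j) + (r * g i j)\<^sup>2"
        unfolding re by (simp add: power2_eq_square algebra_simps)
      finally show ?thesis using True rg by (simp add: r_def)
    next
      case False
      then show ?thesis using rg by (auto simp: r_def g_def)
    qed
  qed
  have "(\<Sum>i<n. \<Sum>j<n. (\<epsilon> ^ s j / \<epsilon> ^ s i * cmod ((if Suc i = j \<and> i \<in> C then 1 else 0) + G $$ (i, j)))\<^sup>2)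
      \<le> (\<Sum>i<n. \<Sum>j<n. (if Suc i = j \<and> i \<in> C then \<epsilon>\<^sup>2 * (1 + 2 * g i j) else 0) + (g i j / \<epsilon> ^ (m - 1))\<^sup>2)"
    using entry by (intro sum_mono) auto
  also have "\<dots> = (\<Sum>i<n. \<Sum>j<n. if Suc i = j \<and> i \<in> C then \<epsilon>\<^sup>2 * (1 + 2 * g i j) else 0)
      + (frobenius_norm G / \<epsilon> ^ (m - 1))\<^sup>2"
    by (simp add: sum.distrib power_divide frobenius_norm_sq[OF G] g_def sum_divide_distrib)
  also have "(\<Sum>i<n. \<Sum>j<n. if Suc i = j \<and> i \<in> C then \<epsilon>\<^sup>2 * (1 + 2 * g i j) else 0)
      = (\<Sum>i<n. if i \<in> C then \<epsilon>\<^sup>2 * (1 + 2 * g i (Suc i)) else 0)"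
  proof (rule sum.cong[OF refl])
    fix i
    show "(\<Sum>j<n. if Suc i = j \<and> i \<in> C then \<epsilon>\<^sup>2 * (1 + 2 * g i j) else 0)
        = (if i \<in> C then \<epsilon>\<^sup>2 * (1 + 2 * g i (Suc i)) else 0)"
      using C(1)[of i] by (cases "i \<in> C") (auto simp: sum.delta)
  qed
  also have "\<dots> = (\<Sum>i\<in>C. \<epsilon>\<^sup>2 * (1 + 2 * g i (Suc i)))"
    using C(1) by (subst sum.inter_restrict[symmetric])
      (auto intro!: sum.cong dest: Suc_lessD)
  also have "\<dots> = \<epsilon>\<^sup>2 * (real (card C) + 2 * (\<Sum>i\<in>C. g i (Suc i)))"
    by (simp add: sum.distrib sum_distrib_left[symmetric])
  finally have bound: "(\<Sum>i<n. \<Sum>j<n. (\<epsilon> ^ s j / \<epsilon> ^ s i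
        * cmod ((if Suc i = j \<and> i \<in> C then 1 else 0) + G $$ (i, j)))\<^sup>2)
      \<le> \<epsilon>\<^sup>2 * (real (card C) + 2 * (\<Sum>i\<in>C. g i (Suc i))) + (frobenius_norm G / \<epsilon> ^ (m - 1))\<^sup>2" .
  have "(\<Sum>i\<in>C. g i (Suc i)) \<le> sqrt (real (card C)) * frobenius_norm G"
  proof -
    have "(\<Sum>i\<in>C. (g i (Suc i))\<^sup>2) \<le> (\<Sum>i<n. \<Sum>j<n. (g i j)\<^sup>2)"
    proof -
      have "(\<Sum>i\<in>C. (g i (Suc i))\<^sup>2) \<le> (\<Sum>i\<in>C. \<Sum>j<n. (g i j)\<^sup>2)"
        using C(1) by (intro sum_mono member_le_sum) auto
      also have "\<dots> \<le> (\<Sum>i<n. \<Sum>j<n. (g i j)\<^sup>2)"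
        using C(1) by (intro sum_mono2) (auto intro: sum_nonneg dest: Suc_lessD)
      finally show ?thesis .
    qed
    then have "sqrt (\<Sum>i\<in>C. (g i (Suc i))\<^sup>2) \<le> frobenius_norm G"
      using frobenius_norm_sq[OF G] frobenius_norm_nonneg[of G]
      by (simp add: g_def real_le_lsqrt sum_nonneg)
    then have "sqrt (real (card C)) * sqrt (\<Sum>i\<in>C. (g i (Suc i))\<^sup>2) \<le> sqrt (real (card C)) * frobenius_norm G"
      by (rule mult_left_mono) simp
    moreover have "(\<Sum>i\<in>C. g i (Suc i)) = (\<Sum>i\<in>C. \<bar>g i (Suc i)\<bar>)"
      by (simp add: g_def)
    ultimately show ?thesis
      using sum_le_sqrt_card_mult[of "\<lambda>i. g i (Suc i)" C] by linarith
  qed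
  then have "\<epsilon>\<^sup>2 * (real (card C) + 2 * (\<Sum>i\<in>C. g i (Suc i)))
      \<le> \<epsilon>\<^sup>2 * (real (card C) + 2 * sqrt (real (card C)) * frobenius_norm G)"
    by (intro mult_left_mono) auto
  with bound show ?thesis by linarith
qed

text \<open>Steiner's identity: \<open>t\<close> is the mean of the \<open>z k\<close>.\<close>
lemma sum_sq_shift_mean:
  fixes z :: "nat \<Rightarrow> complex"
  assumes "(\<Sum>k<n. z k) = of_nat n * t"
  shows "(\<Sum>k<n. (cmod (z k))\<^sup>2) = (\<Sum>k<n. (cmod (z k - t))\<^sup>2) + real n * (cmod t)\<^sup>2"
proof -
  have "(cmod (z k - t))\<^sup>2 = (cmod (z k))\<^sup>2 - 2 * Re (z k * cnj t) + (cmod t)\<^sup>2" for k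
    unfolding cmod_power2 by (simp add: power2_eq_square algebra_simps)
  then have "(\<Sum>k<n. (cmod (z k - t))\<^sup>2)
      = (\<Sum>k<n. (cmod (z k))\<^sup>2) - 2 * Re ((\<Sum>k<n. z k) * cnj t) + real n * (cmod t)\<^sup>2"
    by (simp add: sum.distrib sum_subtractf sum_distrib_left[symmetric] sum_distrib_right[symmetric] Re_sum)
  also have "Re ((\<Sum>k<n. z k) * cnj t) = real n * (cmod t)\<^sup>2"
    unfolding assms cmod_power2 by (simp add: power2_eq_square algebra_simps)
  finally show ?thesis by simp
qed

text \<open>\<open>delta Y\<close> is the Frobenius distance from \<open>Y\<close> to the scalar matrices; the nearest one has the mean of the
diagonal entries of \<open>Y\<close> on its diagonal.\<close>
lemma delta_eq_frobenius_norm: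
  assumes Y: "Y \<in> carrier_mat n n" and n: "0 < n" and t: "t = mat_trace Y / of_nat n"
  shows "delta Y = frobenius_norm (Y - mat_diag n (\<lambda>_. t))"
proof -
  have "(frobenius_norm (Y - mat_diag n (\<lambda>_. t)))\<^sup>2
      = (\<Sum>i<n. \<Sum>j<n. (cmod ((Y - mat_diag n (\<lambda>_. t)) $$ (i, j)))\<^sup>2)"
    by (rule frobenius_norm_sq) (auto simp: mat_diag_def)
  also have "\<dots> = (\<Sum>i<n. \<Sum>j<n. (cmod (Y $$ (i, j)))\<^sup>2
          + (if i = j then (cmod (Y $$ (i, j) - t))\<^sup>2 - (cmod (Y $$ (i, j)))\<^sup>2 else 0))"
    using Y by (intro sum.cong refl) (auto simp: mat_diag_def)
  also have "\<dots> = (frobenius_norm Y)\<^sup>2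
      + ((\<Sum>i<n. (cmod (Y $$ (i, i) - t))\<^sup>2) - (\<Sum>i<n. (cmod (Y $$ (i, i)))\<^sup>2))"
    by (simp add: sum.distrib sum_sum_if_eq frobenius_norm_sq[OF Y] sum_subtractf)
  also have "(\<Sum>i<n. (cmod (Y $$ (i, i)))\<^sup>2)
      = (\<Sum>i<n. (cmod (Y $$ (i, i) - t))\<^sup>2) + real n * (cmod t)\<^sup>2"
    using Y n t by (intro sum_sq_shift_mean) (simp add: mat_trace_def)
  also have "real n * (cmod t)\<^sup>2 = 1 / real n * (cmod (mat_trace Y))\<^sup>2"
    using n by (simp add: t norm_divide power_divide power2_eq_square)
  finally show ?thesis
    unfolding delta_def using Y frobenius_norm_nonneg[of "Y - mat_diag n (\<lambda>_. t)"]
    by (simp add: real_sqrt_unique)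
qed

text \<open>The family of bounds, one for each scaling parameter \<open>\<epsilon>\<close>. The mean \<open>t\<close> of the diagonal of \<open>EQ\<close> is moved
into the diagonal matrix with entries \<open>d k + t\<close>, so that only the trace-free part of \<open>EQ\<close> acts as a perturbation.
Since the eigenvalue differences \<open>\<mu> (\<sigma> k) - d k\<close> sum to the trace of \<open>EQ\<close>, undoing the shift adds exactly the
trace term.\<close>
lemma jordan_perturbation_matching:
  fixes EQ :: "complex mat" and \<epsilon> :: real
  assumes n: "0 < n"
    and J: "J = mat n n (\<lambda>(i, j). (if i = j then d i else 0) + (if Suc i = j \<and> i \<in> C then 1 else 0))"
    and C: "\<And>i. i \<in> C \<Longrightarrow> Suc i < n" "\<And>i. i \<in> C \<Longrightarrow> s (Suc i) = Suc (s i)"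
    and s: "\<And>i. i < n \<Longrightarrow> s i < m"
    and EQ: "EQ \<in> carrier_mat n n"
    and cp: "char_poly (J + EQ) = (\<Prod>e\<leftarrow>map \<mu> [0..<n]. [:- e, 1:])"
    and \<epsilon>: "0 < \<epsilon>" "\<epsilon> \<le> 1"
  shows "\<exists>\<sigma>. \<sigma> permutes {..<n} \<and> (\<Sum>k<n. (cmod (\<mu> (\<sigma> k) - d k))\<^sup>2)
    \<le> real n * (\<epsilon>\<^sup>2 * (real (card C) + 2 * sqrt (real (card C)) * delta EQ) + (delta EQ / \<epsilon> ^ (m - 1))\<^sup>2)
      + 1 / real n * (cmod (mat_trace EQ))\<^sup>2"
proof -
  define t where "t = mat_trace EQ / of_nat n"
  define G where "G = EQ - mat_diag n (\<lambda>_. t)"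
  have G: "G \<in> carrier_mat n n" by (simp add: G_def minus_carrier_mat)
  have \<delta>: "delta EQ = frobenius_norm G"
    unfolding G_def by (rule delta_eq_frobenius_norm[OF EQ n t_def])
  have Jc: "J \<in> carrier_mat n n" by (simp add: J)
  have JE: "J + EQ \<in> carrier_mat n n" using EQ by simp
  \<comment> \<open>the scaling turns the superdiagonal ones into \<open>\<epsilon>\<close>, because \<open>s\<close> increases by one along each of them\<close>
  define P where "P = mat_diag n (\<lambda>i. complex_of_real (1 / \<epsilon> ^ s i))"
  define R where "R = mat_diag n (\<lambda>i. complex_of_real (\<epsilon> ^ s i))"
  have PR: "P \<in> carrier_mat n n" "R \<in> carrier_mat n n" by (simp_all add: P_def R_def)
  have inv: "P * R = 1\<^sub>m n" "R * P = 1\<^sub>m n"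
    using \<epsilon> by (simp_all add: P_def R_def)
  define M where "M = P * (J + EQ) * R"
  have M: "M \<in> carrier_mat n n" unfolding M_def using PR JE by simp
  have "similar_mat M (J + EQ)"
    by (rule similar_matI[of _ _ P R n]) (use M PR JE inv M_def in auto)
  then have cpM: "char_poly M = (\<Prod>e\<leftarrow>map \<mu> [0..<n]. [:- e, 1:])"
    using cp char_poly_similar by metis
  have Mij: "M $$ (i, j) = of_real (\<epsilon> ^ s j / \<epsilon> ^ s i) * (J + EQ) $$ (i, j)" if "i < n" "j < n" for i j
  proof -
    have "P * (J + EQ) = mat n n (\<lambda>(i, j). of_real (1 / \<epsilon> ^ s i) * (J + EQ) $$ (i, j))"
      unfolding P_def by (rule mat_diag_mult_left[OF JE])
    moreover have "M = mat n n (\<lambda>(i, j). (P * (J + EQ)) $$ (i, j) * of_real (\<epsilon> ^ s j))"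
      unfolding M_def R_def by (rule mat_diag_mult_right[OF mult_carrier_mat[OF PR(1) JE]])
    ultimately show ?thesis using that by simp
  qed
  obtain \<sigma> where \<sigma>: "\<sigma> permutes {..<n}" and le: "(\<Sum>k<n. (cmod (\<mu> (\<sigma> k) - (d k + t)))\<^sup>2)
      \<le> real n * (frobenius_norm (M - mat_diag n (\<lambda>k. d k + t)))\<^sup>2"
    using eigenvalue_variation_diag[OF M cpM, of "\<lambda>k. d k + t"] by blast
  have "(frobenius_norm (M - mat_diag n (\<lambda>k. d k + t)))\<^sup>2
      = (\<Sum>i<n. \<Sum>j<n. (cmod ((M - mat_diag n (\<lambda>k. d k + t)) $$ (i, j)))\<^sup>2)"
    by (rule frobenius_norm_sq) (auto simp: mat_diag_def)
  also have "\<dots> = (\<Sum>i<n. \<Sum>j<n. (\<epsilon> ^ s j / \<epsilon> ^ s i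
      * cmod ((if Suc i = j \<and> i \<in> C then 1 else 0) + G $$ (i, j)))\<^sup>2)"
  proof (intro sum.cong refl)
    fix i j assume "i \<in> {..<n}" "j \<in> {..<n}"
    then have ij: "i < n" "j < n" by auto
    have "(M - mat_diag n (\<lambda>k. d k + t)) $$ (i, j) = of_real (\<epsilon> ^ s j / \<epsilon> ^ s i)
        * ((if Suc i = j \<and> i \<in> C then 1 else 0) + G $$ (i, j))"
      using ij EQ M \<epsilon> by (auto simp: Mij J G_def mat_diag_def algebra_simps)
    moreover have "\<bar>\<epsilon> ^ s j / \<epsilon> ^ s i\<bar> = \<epsilon> ^ s j / \<epsilon> ^ s i" using \<epsilon> by simp
    ultimately show "(cmod ((M - mat_diag n (\<lambda>k. d k + t)) $$ (i, j)))\<^sup>2 = (\<epsilon> ^ s j / \<epsilon> ^ s i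
        * cmod ((if Suc i = j \<and> i \<in> C then 1 else 0) + G $$ (i, j)))\<^sup>2"
      by (simp only: norm_mult norm_of_real)
  qed
  also have "\<dots> \<le> \<epsilon>\<^sup>2 * (real (card C) + 2 * sqrt (real (card C)) * delta EQ) + (delta EQ / \<epsilon> ^ (m - 1))\<^sup>2"
    unfolding \<delta> by (rule scaled_perturbation_bound[where C = C and s = s and m = m, OF G \<epsilon> C s])
  finally have "real n * (frobenius_norm (M - mat_diag n (\<lambda>k. d k + t)))\<^sup>2
      \<le> real n * (\<epsilon>\<^sup>2 * (real (card C) + 2 * sqrt (real (card C)) * delta EQ) + (delta EQ / \<epsilon> ^ (m - 1))\<^sup>2)"
    by (rule mult_left_mono) simp
  note le = order_trans[OF le this]
  have "(\<Sum>k<n. \<mu> (\<sigma> k)) = (\<Sum>k<n. \<mu> k)"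
    using sum.permute[OF \<sigma>, of \<mu>] by (simp add: o_def)
  also have "\<dots> = mat_trace (J + EQ)"
    by (rule mat_trace_eq_sum_eigenvalues[OF JE cp, symmetric])
  also have "\<dots> = (\<Sum>k<n. d k) + of_nat n * t"
    using EQ n by (simp add: mat_trace_def J t_def sum.distrib)
  finally have "(\<Sum>k<n. \<mu> (\<sigma> k) - d k) = of_nat n * t"
    by (simp add: sum_subtractf)
  from sum_sq_shift_mean[OF this] have "(\<Sum>k<n. (cmod (\<mu> (\<sigma> k) - d k))\<^sup>2)
      = (\<Sum>k<n. (cmod (\<mu> (\<sigma> k) - (d k + t)))\<^sup>2) + real n * (cmod t)\<^sup>2"
    by (simp add: algebra_simps)
  moreover have "real n * (cmod t)\<^sup>2 = 1 / real n * (cmod (mat_trace EQ))\<^sup>2"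
    using n by (simp add: t_def norm_divide power_divide power2_eq_square)
  ultimately show ?thesis using \<sigma> le by auto
qed

section \<open>The matching of the spectra\<close>

text \<open>Lets \<open>\<epsilon>\<close> tend to \<open>0\<close> although the matching depends on \<open>\<epsilon>\<close>: there are only finitely many permutations.\<close>
lemma finite_attains_infimum_bound:
  fixes f :: "'a \<Rightarrow> real"
  assumes P: "finite P" and le: "\<And>e. 0 < e \<Longrightarrow> \<exists>x\<in>P. f x \<le> K + e"
  shows "\<exists>x\<in>P. f x \<le> K"
proof (rule ccontr)
  assume no: "\<not> ?thesis"
  have "P \<noteq> {}" using le[of 1] by auto
  then have "Min (f ` P) \<in> f ` P" using P by simp
  then have "K < Min (f ` P)" using no by auto
  then obtain x where "x \<in> P" "f x \<le> K + (Min (f ` P) - K) / 2"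
    using le[of "(Min (f ` P) - K) / 2"] by auto
  moreover have "Min (f ` P) \<le> f x" using \<open>x \<in> P\<close> P by simp
  ultimately show False using \<open>K < Min (f ` P)\<close> by (simp add: field_simps)
qed

lemma permutes_shift_Suc:
  assumes \<sigma>: "\<sigma> permutes {..<n}"
  shows "(\<lambda>j. if j \<in> {1..n} then Suc (\<sigma> (j - 1)) else j) permutes {1..n}"
proof (rule bij_imp_permutes)
  let ?\<rho> = "\<lambda>j. if j \<in> {1..n} then Suc (\<sigma> (j - 1)) else j"
  have "?\<rho> j \<in> {1..n}" if "j \<in> {1..n}" for j
  proof -
    have "j - 1 < n" using that by auto
    then have "\<sigma> (j - 1) < n" using permutes_in_image[OF \<sigma>, of "j - 1"] by simp
    then show ?thesis using that by simp
  qed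
  then have "?\<rho> ` {1..n} \<subseteq> {1..n}" by blast
  moreover have "inj_on ?\<rho> {1..n}"
  proof (rule inj_onI)
    fix i j assume ij: "i \<in> {1..n}" "j \<in> {1..n}" "?\<rho> i = ?\<rho> j"
    then have "\<sigma> (i - 1) = \<sigma> (j - 1)" by simp
    then have "i - 1 = j - 1" using permutes_inj[OF \<sigma>] by (simp add: inj_eq)
    with ij(1,2) show "i = j" by auto
  qed
  ultimately show "bij_betw ?\<rho> {1..n} {1..n}"
    unfolding bij_betw_def using endo_inj_surj[OF finite_atLeastAtMost] by blast
qed auto

theorem theorem3p3:
  fixes n p m :: nat
    and A At E Q Qinv EQ :: "complex mat"
    and Js :: "(nat \<times> complex) list"
    and lam lamt :: "nat \<Rightarrow> complex"
  assumes "n \<ge> 1"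
    and "A \<in> carrier_mat n n"
    and "E \<in> carrier_mat n n"
    and "Q \<in> carrier_mat n n"
    and "Qinv \<in> carrier_mat n n"
    and "inverts_mat Q Qinv"
    and "inverts_mat Qinv Q"
    and "length Js = p"
    and "\<forall>(k, a) \<in> set Js. k \<ge> 1"
    and "sum_list (map fst Js) = n"
    and "A = Q * diag_block_mat (map (\<lambda>(k, a). jordan_block k a) Js) * Qinv"
    and "At = A + E"
    and "spectrum_listing n A lam"
    and "spectrum_listing n At lamt"
    and "m = Max (fst ` set Js)"
    and "EQ = Qinv * E * Q"
  shows "\<exists>\<pi>. \<pi> permutes {1..n} \<and>
    sqrt (\<Sum>i = 1..n. (cmod (lamt (\<pi> i) - lam i))\<^sup>2) \<le>
      (if delta EQ < 1
       then sqrt (real n * (real n - real p + 2 * sqrt (real n - real p) * delta EQ + 1)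
                    * delta EQ powr (2 / real m)
                  + 1 / real n * (cmod (mat_trace E))\<^sup>2)
       else sqrt (real n * (sqrt (real n - real p) + delta EQ)\<^sup>2
                  + 1 / real n * (cmod (mat_trace E))\<^sup>2))"
proof -
  note n = assms(1) and A = assms(2) and E = assms(3) and Q = assms(4) and Qi = assms(5)
  have n0: "0 < n" using n by simp
  define J where "J = diag_block_mat (map (\<lambda>(k, a). jordan_block k a) Js)"
  have "Js \<noteq> []" using n assms(10) by auto
  then obtain k a where ka: "(k, a) \<in> set Js" by (cases Js) auto
  have le_m: "k \<le> m" if "(k, a) \<in> set Js" for k a
    unfolding assms(15) using that by (intro Max_ge) (auto intro: rev_image_eqI)
  have m: "1 \<le> m" using ka le_m[OF ka] assms(9) by auto
  have "\<forall>(k, a) \<in> set Js. 1 \<le> k \<and> k \<le> m" using assms(9) le_m by auto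
  from jordan_matrix_structure[OF this] obtain d C s where
    Jmat: "J = mat n n (\<lambda>(i, j). (if i = j then d i else 0) + (if Suc i = j \<and> i \<in> C then 1 else 0))"
    and C: "\<And>i. i \<in> C \<Longrightarrow> Suc i < n" "\<And>i. i \<in> C \<Longrightarrow> s (Suc i) = Suc (s i)"
    and s: "\<And>i. i < n \<Longrightarrow> s i < m" and cardC: "card C + p = n"
    unfolding Let_def assms(10) assms(8) J_def by blast
  have cC: "real (card C) = real n - real p" using cardC by simp
  have Jc: "J \<in> carrier_mat n n" by (simp add: Jmat)
  have QQ: "Q * Qinv = 1\<^sub>m n" "Qinv * Q = 1\<^sub>m n"
    using assms(6,7) Q Qi by (auto simp: inverts_mat_def)
  have EQc: "EQ \<in> carrier_mat n n" unfolding assms(16) using E Q Qi by simp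
  have AJ: "A = Q * J * Qinv" using assms(11) by (simp add: J_def)
  have At: "At \<in> carrier_mat n n" using assms(12) A E by simp

  have "similar_mat A J"
    by (rule similar_matI[of _ _ Q Qinv n]) (use A Jc Q Qi QQ AJ in auto)
  then have "char_poly A = char_poly J" by (rule char_poly_similar)
  also have "char_poly J = (\<Prod>e\<leftarrow>diag_mat J. [:- e, 1:])"
    by (rule char_poly_upper_triangular[OF Jc]) (auto simp: Jmat)
  also have "diag_mat J = map d [0..<n]"
    by (auto simp: diag_mat_def Jmat)
  finally have cpA: "char_poly A = (\<Prod>e\<leftarrow>map d [0..<n]. [:- e, 1:])" .
  have "image_mset lam (mset_set {1..n}) = mset (map d [0..<n])"
    by (rule spectrum_listing_mset[OF assms(13) cpA])
  also have "\<dots> = image_mset (\<lambda>j. d (j - 1)) (image_mset Suc (mset_set {..<n}))"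
    by (simp add: multiset.map_comp o_def lessThan_atLeast0)
  also have "image_mset Suc (mset_set {..<n}) = mset_set (Suc ` {..<n})"
    by (rule image_mset_mset_set) simp
  also have "Suc ` {..<n} = {1..n}" by (auto simp: image_iff Suc_le_eq gr0_conv_Suc)
  finally obtain \<tau> where \<tau>: "\<tau> permutes {1..n}" and lam: "\<forall>j\<in>{1..n}. lam j = d (\<tau> j - 1)"
    using image_mset_eq_implies_permutes[of "{1..n}" lam "\<lambda>j. d (j - 1)"] by auto

  \<comment> \<open>\<open>\<mu>\<close> and \<open>d\<close> list the two spectra with indices starting at \<open>0\<close>\<close>
  define \<mu> where "\<mu> i = lamt (Suc i)" for i
  have "Qinv * A * Q = J"
  proof -
    have "Qinv * A = Qinv * Q * (J * Qinv)"
      unfolding AJ assoc_mult_mat[OF Q Jc Qi]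
      by (rule assoc_mult_mat[symmetric, OF Qi Q mult_carrier_mat[OF Jc Qi]])
    also have "\<dots> = J * Qinv"
      unfolding QQ by (rule left_mult_one_mat[OF mult_carrier_mat[OF Jc Qi]])
    finally have "Qinv * A * Q = J * (Qinv * Q)"
      using assoc_mult_mat[OF Jc Qi Q] by simp
    then show ?thesis unfolding QQ using Jc by simp
  qed
  then have JEQ: "J + EQ = Qinv * At * Q"
    unfolding assms(12,16) mult_add_distrib_mat[OF Qi A E]
      add_mult_distrib_mat[OF mult_carrier_mat[OF Qi A] mult_carrier_mat[OF Qi E] Q] by simp
  have "similar_mat (J + EQ) At"
    by (rule similar_matI[of _ _ Qinv Q n]) (use At Jc EQc Q Qi QQ JEQ in auto)
  then have cp: "char_poly (J + EQ) = (\<Prod>e\<leftarrow>map \<mu> [0..<n]. [:- e, 1:])"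
    using char_poly_similar spectrum_listing_char_poly[OF assms(14) At] unfolding \<mu>_def by metis
  have tr: "mat_trace EQ = mat_trace E"
    unfolding assms(16) by (rule mat_trace_similar[OF Qi E Q QQ(1)])

  define \<delta> where "\<delta> = delta EQ"
  define c where "c = real n - real p"
  define cost where "cost \<sigma> = (\<Sum>k<n. (cmod (\<mu> (\<sigma> k) - d k))\<^sup>2)" for \<sigma>
  define T where "T = 1 / real n * (cmod (mat_trace E))\<^sup>2"
  have c0: "0 \<le> c" using cC by (simp add: c_def)
  have \<delta>0: "0 \<le> \<delta>"
    using delta_eq_frobenius_norm[OF EQc _ refl] n by (simp add: \<delta>_def frobenius_norm_nonneg)
  have bound: "\<exists>\<sigma>. \<sigma> permutes {..<n} \<and> cost \<sigma>
      \<le> real n * (\<epsilon>\<^sup>2 * (c + 2 * sqrt c * \<delta>) + (\<delta> / \<epsilon> ^ (m - 1))\<^sup>2) + T"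
    if "0 < \<epsilon>" "\<epsilon> \<le> 1" for \<epsilon>
    using jordan_perturbation_matching[where C = C and s = s and m = m, OF n0 Jmat C s EQc cp that]
    unfolding cC tr cost_def T_def c_def \<delta>_def .
  define K where "K = (if \<delta> < 1 then real n * (c + 2 * sqrt c * \<delta> + 1) * \<delta> powr (2 / real m) + T
    else real n * (sqrt c + \<delta>)\<^sup>2 + T)"
  have "\<exists>\<sigma>. \<sigma> permutes {..<n} \<and> cost \<sigma> \<le> K"
  proof -
    consider "\<delta> = 0" | "0 < \<delta>" "\<delta> < 1" | "1 \<le> \<delta>" using \<delta>0 by linarith
    then show ?thesis
    proof cases
      case 1
      \<comment> \<open>the optimal \<open>\<epsilon>\<close> would be \<open>0\<close>, which makes the scaling singular, so pass to the limit\<close>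
      have "\<exists>\<sigma>\<in>{\<sigma>. \<sigma> permutes {..<n}}. cost \<sigma> \<le> T"
      proof (rule finite_attains_infimum_bound)
        fix e :: real assume e: "0 < e"
        define q where "q = real n * c + 1"
        have q: "0 < q" "real n * c \<le> q" using c0 by (simp_all add: q_def add_nonneg_pos)
        define \<epsilon> where "\<epsilon> = min 1 (e / q)"
        have \<epsilon>: "0 < \<epsilon>" "\<epsilon> \<le> 1" "\<epsilon> * q \<le> e"
          using e q by (auto simp: \<epsilon>_def min_def field_simps)
        have "\<epsilon>\<^sup>2 * (real n * c) \<le> \<epsilon> * q"
          using \<epsilon> q c0 by (intro mult_mono) (auto simp: power2_eq_square mult_left_le)
        then have "real n * (\<epsilon>\<^sup>2 * (c + 2 * sqrt c * \<delta>) + (\<delta> / \<epsilon> ^ (m - 1))\<^sup>2) + T \<le> T + e"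
          using \<epsilon>(3) 1 by (simp add: algebra_simps)
        then show "\<exists>\<sigma>\<in>{\<sigma>. \<sigma> permutes {..<n}}. cost \<sigma> \<le> T + e"
          using bound[OF \<epsilon>(1,2)] by (auto intro: order_trans)
      qed (simp add: finite_permutations)
      then show ?thesis using 1 by (simp add: K_def)
    next
      case 2
      \<comment> \<open>chosen so that \<open>\<delta> / \<epsilon> ^ (m - 1) = \<epsilon>\<close>, which balances the two terms of the bound\<close>
      define \<epsilon> where "\<epsilon> = \<delta> powr (1 / real m)"
      have \<epsilon>: "0 < \<epsilon>" "\<epsilon> \<le> 1" using 2 by (simp_all add: \<epsilon>_def powr_le1)
      have "\<epsilon> ^ m = \<delta>" using 2 m by (simp add: \<epsilon>_def powr_power)
      then have "\<delta> / \<epsilon> ^ (m - 1) = \<epsilon>"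
        using m \<epsilon>(1) by (cases m) (auto simp: field_simps)
      moreover have "\<epsilon>\<^sup>2 = \<delta> powr (2 / real m)" using 2 by (simp add: \<epsilon>_def powr_power)
      ultimately have "real n * (\<epsilon>\<^sup>2 * (c + 2 * sqrt c * \<delta>) + (\<delta> / \<epsilon> ^ (m - 1))\<^sup>2) + T = K"
        using 2 by (simp add: K_def algebra_simps)
      then show ?thesis using bound[OF \<epsilon>] by simp
    next
      case 3
      \<comment> \<open>no scaling: \<open>\<epsilon> = 1\<close> makes the bound a perfect square\<close>
      have "real n * (1\<^sup>2 * (c + 2 * sqrt c * \<delta>) + (\<delta> / 1 ^ (m - 1))\<^sup>2) + T = K"
        using 3 c0 by (simp add: K_def power2_sum)
      then show ?thesis using bound[of 1] by simp
    qed
  qed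
  then obtain \<sigma> where \<sigma>: "\<sigma> permutes {..<n}" and le: "cost \<sigma> \<le> K" by blast

  define \<rho> where "\<rho> j = (if j \<in> {1..n} then Suc (\<sigma> (j - 1)) else j)" for j
  have \<rho>: "\<rho> permutes {1..n}" unfolding \<rho>_def by (rule permutes_shift_Suc[OF \<sigma>])
  have "(\<Sum>i = 1..n. (cmod (lamt ((\<rho> \<circ> \<tau>) i) - lam i))\<^sup>2)
      = (\<Sum>i = 1..n. ((\<lambda>j. (cmod (lamt (\<rho> j) - d (j - 1)))\<^sup>2) \<circ> \<tau>) i)"
    using lam by (intro sum.cong) auto
  also have "\<dots> = (\<Sum>j = 1..n. (cmod (lamt (\<rho> j) - d (j - 1)))\<^sup>2)"
    by (rule sum.permute[OF \<tau>, symmetric])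
  also have "\<dots> = cost \<sigma>"
    unfolding cost_def \<mu>_def by (simp add: sum.atLeast1_atMost_eq \<rho>_def)
  finally have "sqrt (\<Sum>i = 1..n. (cmod (lamt ((\<rho> \<circ> \<tau>) i) - lam i))\<^sup>2) \<le> sqrt K"
    using le by simp
  then show ?thesis
    using permutes_compose[OF \<tau> \<rho>] unfolding K_def T_def c_def \<delta>_def
    by (intro exI[of _ "\<rho> \<circ> \<tau>"]) (auto split: if_splits)
qed

end
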